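(* Let $W$ be a BKL-positive word and let $p\ge 0$ be an integer. Suppose that the braid $X=W\delta^{-p}\in\mathbf{B}_3$ is quasipositive. Then every orbit of the Hurwitz action on quasipositive factorizations of $X$ contains an element of the form $W_I$ with $W$-minimal $I$.
   Context: $\mathbf{B}_3=\langle\sigma_1,\sigma_2\mid\sigma_1\sigma_2\sigma_1=\sigma_2\sigma_1\sigma_2\rangle$ is the group of braids with three strings. Put $\sigma_0=\sigma_1^{-1}\sigma_2\sigma_1$ and $\delta=\sigma_2\sigma_1$; the Birman--Ko--Lee (BKL) presentation is $\mathbf{B}_3=\langle\sigma_0,\sigma_1,\sigma_2\mid\sigma_2\sigma_1=\sigma_1\sigma_0=\sigma_0\sigma_2\rangle$. A BKL-positive word is a word over the alphabet $\{\sigma_0,\sigma_1,\sigma_2\}$ (no inverses); a word also denotes the braid it represents. $\equiv$ denotes letterwise coincidence of words, and $=$ denotes equality in $\mathbf{B}_3$. A quasipositive factorization of $X\in\mathbf{B}_3$ is a tuple $(X_1,\dots,X_k)\in\mathbf{B}_3^k$ such that $X_1\cdots X_k=X$ and each $X_i$ is conjugate in $\mathbf{B}_3$ to $\sigma_1$. A braid is quasipositive if it admits at least one quasipositive factorization. For a group $G$ and $1\le i<k$, define $\Sigma_i:G^k\to G^k$ by $\Sigma_i(X_1,\dots,X_k)=(Y_1,\dots,Y_k)$ where $(Y_i,Y_{i+1})=(X_iX_{i+1}X_i^{-1},X_i)$ and $Y_j=X_j$ for $j\notin\{i,i+1\}$. These maps are invertible, and $\sigma_i\mapsto\Sigma_i$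 defines an action of the braid group $\mathbf{B}_k$ on $G^k$, called the Hurwitz action. With $G=\mathbf{B}_3$ it preserves the set of quasipositive factorizations (of length $k$) of a given braid. Let $W\equiv a_1\dots a_n$ be a BKL-positive word and $I=\{i_1,\dots,i_k\}$, $1\le i_1<\dots<i_k\le n$. Put $x_j=a_{i_j}$, $i_0=0$, $i_{k+1}=n+1$, and let $W_j\equiv a_l\dots a_m$ with $l=i_{j-1}+1$, $m=i_j-1$ ($1\le j\le k+1$), so that $W\equiv W_1x_1W_2x_2\cdots W_kx_kW_{k+1}$. Put $A_j=W_1\cdots W_j$. Define the word $W\setminus I\equiv W_1\cdots W_{k+1}$ and the tuple $W_I=(A_1x_1A_1^{-1},\dots,A_kx_kA_k^{-1})\in\mathbf{B}_3^k$. ($W_I$ is a quasipositive factorization of $W\delta^{-p}$ if and only if $W\setminus I=\delta^p$ in $\mathbf{B}_3$.) $I$ is called $W$-minimal if there is no $i$ such that $i-1\ge 1$, $i-1\notin I$, $i\in I$, and $a_{i-1}=a_i$ (as letters). *)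

theory Defs
  imports "HOL-Algebra.Group_Action"
begin

section \<open>Groups given by generators and relations\<close>

text \<open>
  A word over a set of generators is a list of pairs: \<open>(a, True)\<close> stands for the generator
  \<open>a\<close> and \<open>(a, False)\<close> for its formal inverse.
\<close>

type_synonym 'a gword = "('a \<times> bool) list"

abbreviation gwords :: "'a set \<Rightarrow> 'a gword set" where
  "gwords S \<equiv> lists (S \<times> UNIV)"

inductive pres_eq :: "'a set \<Rightarrow> ('a gword \<times> 'a gword) set \<Rightarrow> 'a gword \<Rightarrow> 'a gword \<Rightarrow> bool"
  for S R where
  refl: "w \<in> gwords S \<Longrightarrow> pres_eq S R w w"
| sym: "pres_eq S R u v \<Longrightarrow> pres_eq S R v u"
| trans: "pres_eq S R u v \<Longrightarrow> pres_eq S R v w \<Longrightarrow> pres_eq S R u w"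
| cancel: "u \<in> gwords S \<Longrightarrow> v \<in> gwords S \<Longrightarrow> a \<in> S \<Longrightarrow>
    pres_eq S R (u @ [(a, e), (a, \<not> e)] @ v) (u @ v)"
| relator: "u \<in> gwords S \<Longrightarrow> v \<in> gwords S \<Longrightarrow> (l, r) \<in> R \<Longrightarrow>
    l \<in> gwords S \<Longrightarrow> r \<in> gwords S \<Longrightarrow> pres_eq S R (u @ l @ v) (u @ r @ v)"

definition pres_rel :: "'a set \<Rightarrow> ('a gword \<times> 'a gword) set \<Rightarrow> ('a gword \<times> 'a gword) set" where
  "pres_rel S R = {(u, v). pres_eq S R u v}"

definition presented_group ::
    "'a set \<Rightarrow> ('a gword \<times> 'a gword) set \<Rightarrow> 'a gword set monoid" where
  "presented_group S R =
     \<lparr>carrier = gwords S // pres_rel S R,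
      mult = \<lambda>A B. \<Union>u\<in>A. \<Union>v\<in>B. pres_rel S R `` {u @ v},
      one = pres_rel S R `` {[]}\<rparr>"

definition pres_gen :: "'a set \<Rightarrow> ('a gword \<times> 'a gword) set \<Rightarrow> 'a \<Rightarrow> 'a gword set" where
  "pres_gen S R a = pres_rel S R `` {[(a, True)]}"

fun gword_eval :: "('b, 'c) monoid_scheme \<Rightarrow> ('a \<Rightarrow> 'b) \<Rightarrow> 'a gword \<Rightarrow> 'b" where
  "gword_eval H f [] = \<one>\<^bsub>H\<^esub>"
| "gword_eval H f ((a, e) # w) = (if e then f a else inv\<^bsub>H\<^esub> f a) \<otimes>\<^bsub>H\<^esub> gword_eval H f w"

text \<open>
  The homomorphism from a presented group to \<open>H\<close> that sends each generator \<open>a\<close> to \<open>f a\<close>. It is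
  meaningful when \<open>f\<close> respects the relations; see \<open>pres_hom_group_hom\<close> and \<open>pres_hom_gen\<close>.
\<close>

definition pres_hom :: "('b, 'c) monoid_scheme \<Rightarrow> ('a \<Rightarrow> 'b) \<Rightarrow> 'a gword set \<Rightarrow> 'b" where
  "pres_hom H f A = the_elem (gword_eval H f ` A)"

lemma pres_eq_gwords: "pres_eq S R u v \<Longrightarrow> u \<in> gwords S \<and> v \<in> gwords S"
  by (induction rule: pres_eq.induct) (auto simp: lists_eq_set)

lemma equiv_pres_rel: "equiv (gwords S) (pres_rel S R)"
  unfolding equiv_def
proof (intro conjI)
  show "pres_rel S R \<subseteq> gwords S \<times> gwords S"
    unfolding pres_rel_def using pres_eq_gwords by blast
  show "refl_on (gwords S) (pres_rel S R)"
    by (auto simp: refl_on_def pres_rel_def intro: pres_eq.refl)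
  show "sym_on UNIV (pres_rel S R)"
    by (auto simp: sym_def pres_rel_def intro: pres_eq.sym)
  show "trans_on UNIV (pres_rel S R)"
    by (auto simp: trans_def pres_rel_def intro: pres_eq.trans)
qed

lemma pres_eq_append_left:
  assumes "pres_eq S R u v" "w \<in> gwords S"
  shows "pres_eq S R (w @ u) (w @ v)"
  using assms
proof (induction rule: pres_eq.induct)
  case (refl x)
  then show ?case by (intro pres_eq.refl) (auto simp: lists_eq_set)
next
  case (sym x y)
  then show ?case by (blast intro: pres_eq.sym)
next
  case (trans x y z)
  then show ?case by (blast intro: pres_eq.trans)
next
  case (cancel x y a e)
  then show ?case using pres_eq.cancel[of "w @ x" S y a R e] by (auto simp: lists_eq_set)
next
  case (relator x y l r)
  then show ?case using pres_eq.relator[of "w @ x" S y l r R] by (auto simp: lists_eq_set)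
qed

lemma pres_eq_append_right:
  assumes "pres_eq S R u v" "w \<in> gwords S"
  shows "pres_eq S R (u @ w) (v @ w)"
  using assms
proof (induction rule: pres_eq.induct)
  case (refl x)
  then show ?case by (intro pres_eq.refl) (auto simp: lists_eq_set)
next
  case (sym x y)
  then show ?case by (blast intro: pres_eq.sym)
next
  case (trans x y z)
  then show ?case by (blast intro: pres_eq.trans)
next
  case (cancel x y a e)
  then show ?case using pres_eq.cancel[of x S "y @ w" a R e] by (auto simp: lists_eq_set)
next
  case (relator x y l r)
  then show ?case using pres_eq.relator[of x S "y @ w" l r R] by (auto simp: lists_eq_set)
qed

lemma pres_eq_append:
  assumes "pres_eq S R u u'" "pres_eq S R v v'"
  shows "pres_eq S R (u @ v) (u' @ v')"
proof (rule pres_eq.trans)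
  show "pres_eq S R (u @ v) (u' @ v)"
    using assms pres_eq_gwords by (blast intro: pres_eq_append_right)
  show "pres_eq S R (u' @ v) (u' @ v')"
    using assms pres_eq_gwords by (blast intro: pres_eq_append_left)
qed

lemma pres_mult:
  assumes "u \<in> gwords S" "v \<in> gwords S"
  shows "pres_rel S R `` {u} \<otimes>\<^bsub>presented_group S R\<^esub> pres_rel S R `` {v} = pres_rel S R `` {u @ v}"
proof -
  have *: "pres_rel S R `` {u' @ v'} = pres_rel S R `` {u @ v}"
    if "u' \<in> pres_rel S R `` {u}" "v' \<in> pres_rel S R `` {v}" for u' v'
  proof -
    have "pres_eq S R (u @ v) (u' @ v')"
      using that by (intro pres_eq_append) (auto simp: pres_rel_def)
    then have "(u @ v, u' @ v') \<in> pres_rel S R"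
      by (simp add: pres_rel_def)
    then show ?thesis
      using equiv_class_eq[OF equiv_pres_rel] by metis
  qed
  have ne: "u \<in> pres_rel S R `` {u}" "v \<in> pres_rel S R `` {v}"
    using assms equiv_class_self[OF equiv_pres_rel] by auto
  have "(\<Union>u'\<in>pres_rel S R `` {u}. \<Union>v'\<in>pres_rel S R `` {v}.
      pres_rel S R `` {u' @ v'}) =
      (\<Union>u'\<in>pres_rel S R `` {u}. \<Union>v'\<in>pres_rel S R `` {v}. pres_rel S R `` {u @ v})"
    using * by (intro SUP_cong refl) auto
  also have "\<dots> = pres_rel S R `` {u @ v}"
    using ne by blast
  finally show ?thesis
    by (simp add: presented_group_def)
qed

lemma pres_word_inv:
  assumes "w \<in> gwords S"
  shows "pres_eq S R (rev (map (\<lambda>(a, e). (a, \<not> e)) w) @ w) []"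
  using assms
proof (induction w)
  case Nil
  then show ?case by (auto intro: pres_eq.refl)
next
  case (Cons x w)
  obtain a e where x: "x = (a, e)" by (cases x)
  let ?i = "rev (map (\<lambda>(a, e). (a, \<not> e)) w)"
  have w: "w \<in> gwords S" "?i \<in> gwords S" "a \<in> S"
    using Cons.hyps by (auto simp: in_lists_conv_set x)
  have "pres_eq S R (?i @ [(a, \<not> e), (a, \<not> \<not> e)] @ w) (?i @ w)"
    by (rule pres_eq.cancel) (use w in auto)
  moreover have "pres_eq S R (?i @ w) []"
    by (rule Cons.IH)
  ultimately show ?case
    using pres_eq.trans by (fastforce simp: x)
qed

lemma group_presented_group: "group (presented_group S R)"
proof (rule groupI)
  let ?G = "presented_group S R"
  have carE: "\<exists>u\<in>gwords S. x = pres_rel S R `` {u}" if "x \<in> carrier ?G" for x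
    using that by (auto simp: presented_group_def quotient_def)
  have carI: "pres_rel S R `` {u} \<in> carrier ?G" if "u \<in> gwords S" for u
    using that by (auto simp: presented_group_def quotient_def)
  have app: "u @ v \<in> gwords S" if "u \<in> gwords S" "v \<in> gwords S" for u v :: "'a gword"
    using that by (auto simp: lists_eq_set)
  have one: "\<one>\<^bsub>?G\<^esub> = pres_rel S R `` {[]}"
    by (simp add: presented_group_def)
  show "\<one>\<^bsub>?G\<^esub> \<in> carrier ?G"
    unfolding one by (rule carI) simp
  show "x \<otimes>\<^bsub>?G\<^esub> y \<in> carrier ?G" if xy: "x \<in> carrier ?G" "y \<in> carrier ?G" for x y
  proof -
    obtain u v where "u \<in> gwords S" "x = pres_rel S R `` {u}"
      "v \<in> gwords S" "y = pres_rel S R `` {v}"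
      using carE[OF xy(1)] carE[OF xy(2)] by blast
    then show ?thesis
      using carI[OF app] by (simp add: pres_mult)
  qed
  show "x \<otimes>\<^bsub>?G\<^esub> y \<otimes>\<^bsub>?G\<^esub> z = x \<otimes>\<^bsub>?G\<^esub> (y \<otimes>\<^bsub>?G\<^esub> z)"
    if xyz: "x \<in> carrier ?G" "y \<in> carrier ?G" "z \<in> carrier ?G" for x y z
  proof -
    obtain u v w where "u \<in> gwords S" "x = pres_rel S R `` {u}"
      "v \<in> gwords S" "y = pres_rel S R `` {v}" "w \<in> gwords S" "z = pres_rel S R `` {w}"
      using carE[OF xyz(1)] carE[OF xyz(2)] carE[OF xyz(3)] by blast
    then show ?thesis
      using app by (simp add: pres_mult)
  qed
  show "\<one>\<^bsub>?G\<^esub> \<otimes>\<^bsub>?G\<^esub> x = x" if x: "x \<in> carrier ?G" for x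
  proof -
    obtain u where "u \<in> gwords S" "x = pres_rel S R `` {u}"
      using carE[OF x] by blast
    then show ?thesis
      by (simp add: one pres_mult)
  qed
  show "\<exists>y\<in>carrier ?G. y \<otimes>\<^bsub>?G\<^esub> x = \<one>\<^bsub>?G\<^esub>" if x: "x \<in> carrier ?G" for x
  proof -
    obtain u where u: "u \<in> gwords S" "x = pres_rel S R `` {u}"
      using carE[OF x] by blast
    let ?i = "rev (map (\<lambda>(a, e). (a, \<not> e)) u)"
    have i: "?i \<in> gwords S"
      using u(1) by (auto simp: in_lists_conv_set)
    have "(?i @ u, []) \<in> pres_rel S R"
      using pres_word_inv[OF u(1)] by (simp add: pres_rel_def)
    then have "pres_rel S R `` {?i} \<otimes>\<^bsub>?G\<^esub> x = \<one>\<^bsub>?G\<^esub>"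
      using equiv_class_eq[OF equiv_pres_rel] by (simp add: u pres_mult i one)
    then show ?thesis
      using carI[OF i] by blast
  qed
qed

lemma pres_gen_closed: "a \<in> S \<Longrightarrow> pres_gen S R a \<in> carrier (presented_group S R)"
  by (auto simp: pres_gen_def presented_group_def quotient_def)

lemma gword_eval_closed:
  assumes "group H" "\<And>a. a \<in> S \<Longrightarrow> f a \<in> carrier H" "w \<in> gwords S"
  shows "gword_eval H f w \<in> carrier H"
  using assms(3)
proof (induction w)
  case Nil
  then show ?case using assms(1) by (simp add: group.is_monoid)
next
  case (Cons x w)
  interpret group H by fact
  show ?case
    using Cons assms(2) by (cases x) auto
qed

lemma gword_eval_append:
  assumes "group H" "\<And>a. a \<in> S \<Longrightarrow> f a \<in> carrier H" "u \<in> gwords S" "v \<in> gwords S"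
  shows "gword_eval H f (u @ v) = gword_eval H f u \<otimes>\<^bsub>H\<^esub> gword_eval H f v"
  using assms(3)
proof (induction u)
  case Nil
  interpret group H by fact
  show ?case using gword_eval_closed[OF assms(1,2,4)] by simp
next
  case (Cons x u)
  interpret group H by fact
  have u: "u \<in> gwords S" and x: "fst x \<in> S" using Cons.hyps by (simp_all add: mem_Times_iff)
  show ?case
    using Cons.IH x gword_eval_closed[OF assms(1,2) u] gword_eval_closed[OF assms(1,2,4)]
      assms(2)[OF x]
    by (cases x) (auto simp: m_assoc)
qed

lemma gword_eval_pres_eq:
  assumes "group H" "\<And>a. a \<in> S \<Longrightarrow> f a \<in> carrier H"
    and rel: "\<And>l r. (l, r) \<in> R \<Longrightarrow> l \<in> gwords S \<Longrightarrow> r \<in> gwords S \<Longrightarrow>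
      gword_eval H f l = gword_eval H f r"
    and "pres_eq S R u v"
  shows "gword_eval H f u = gword_eval H f v"
  using assms(4)
proof (induction rule: pres_eq.induct)
  case (cancel u v a e)
  interpret group H by fact
  note [simp] = gword_eval_append[OF assms(1,2)] gword_eval_closed[OF assms(1,2)]
  have "gword_eval H f [(a, e), (a, \<not> e)] = \<one>\<^bsub>H\<^esub>"
    using cancel assms(2) by auto
  moreover have "[(a, e), (a, \<not> e)] \<in> gwords S"
    using cancel by simp
  ultimately show ?case
    using cancel by (simp del: gword_eval.simps append_Cons append_Nil add: append_in_lists_conv)
next
  case (relator u v l r)
  note [simp] = gword_eval_append[OF assms(1,2)]
  show ?case
    using relator rel[of l r] by (simp add: append_in_lists_conv)
qed auto

lemma pres_hom_class:
  assumes "group H" "\<And>a. a \<in> S \<Longrightarrow> f a \<in> carrier H"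
    and "\<And>l r. (l, r) \<in> R \<Longrightarrow> l \<in> gwords S \<Longrightarrow> r \<in> gwords S \<Longrightarrow>
      gword_eval H f l = gword_eval H f r"
    and "w \<in> gwords S"
  shows "pres_hom H f (pres_rel S R `` {w}) = gword_eval H f w"
proof -
  have "gword_eval H f u = gword_eval H f w" if "u \<in> pres_rel S R `` {w}" for u
    using gword_eval_pres_eq[OF assms(1,2,3)] that by (auto simp: pres_rel_def)
  moreover have "w \<in> pres_rel S R `` {w}"
    using assms(4) by (rule equiv_class_self[OF equiv_pres_rel])
  ultimately have "gword_eval H f ` (pres_rel S R `` {w}) = {gword_eval H f w}"
    by blast
  then show ?thesis
    by (simp add: pres_hom_def)
qed

lemma pres_hom_gen:
  assumes "group H" "\<And>a. a \<in> S \<Longrightarrow> f a \<in> carrier H"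
    and "\<And>l r. (l, r) \<in> R \<Longrightarrow> l \<in> gwords S \<Longrightarrow> r \<in> gwords S \<Longrightarrow>
      gword_eval H f l = gword_eval H f r"
    and "a \<in> S"
  shows "pres_hom H f (pres_gen S R a) = f a"
proof -
  interpret group H by fact
  show ?thesis
    using pres_hom_class[OF assms(1-3), where w = "[(a, True)]"] assms(2,4)
    by (simp add: pres_gen_def)
qed

lemma pres_hom_group_hom:
  assumes "group H" "\<And>a. a \<in> S \<Longrightarrow> f a \<in> carrier H"
    and "\<And>l r. (l, r) \<in> R \<Longrightarrow> l \<in> gwords S \<Longrightarrow> r \<in> gwords S \<Longrightarrow>
      gword_eval H f l = gword_eval H f r"
  shows "group_hom (presented_group S R) H (pres_hom H f)"
proof -
  have "pres_hom H f \<in> hom (presented_group S R) H"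
  proof (rule homI)
    fix x assume "x \<in> carrier (presented_group S R)"
    then obtain u where "u \<in> gwords S" "x = pres_rel S R `` {u}"
      by (auto simp: presented_group_def quotient_def)
    then show "pres_hom H f x \<in> carrier H"
      using pres_hom_class[OF assms] gword_eval_closed[OF assms(1,2)] by simp
  next
    fix x y assume "x \<in> carrier (presented_group S R)" "y \<in> carrier (presented_group S R)"
    then obtain u v where "u \<in> gwords S" "x = pres_rel S R `` {u}"
      "v \<in> gwords S" "y = pres_rel S R `` {v}"
      by (auto simp: presented_group_def quotient_def)
    then show "pres_hom H f (x \<otimes>\<^bsub>presented_group S R\<^esub> y) = pres_hom H f x \<otimes>\<^bsub>H\<^esub> pres_hom H f y"
      using pres_hom_class[OF assms] gword_eval_append[OF assms(1,2)]
      by (simp add: pres_mult append_in_lists_conv)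
  qed
  then show ?thesis
    using assms(1) group_presented_group by (intro group_hom.intro group_hom_axioms.intro) auto
qed


section \<open>Braid groups\<close>

text \<open>Artin's presentation of the group of braids with \<open>n\<close> strings, with generators
  indexed by \<open>{1..<n}\<close>.\<close>

definition artin_relations :: "nat \<Rightarrow> (nat gword \<times> nat gword) set" where
  "artin_relations n =
     {([(i, True), (Suc i, True), (i, True)], [(Suc i, True), (i, True), (Suc i, True)]) | i.
        1 \<le> i \<and> Suc i < n}
   \<union> {([(i, True), (j, True)], [(j, True), (i, True)]) | i j.
        1 \<le> i \<and> i + 2 \<le> j \<and> j < n}"

definition braid_group :: "nat \<Rightarrow> nat gword set monoid" where
  "braid_group n = presented_group {1..<n} (artin_relations n)"

definition braid_gen :: "nat \<Rightarrow> nat \<Rightarrow> nat gword set" where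
  "braid_gen n i = pres_gen {1..<n} (artin_relations n) i"

type_synonym braid = "nat gword set"

abbreviation B3 :: "braid monoid" where
  "B3 \<equiv> braid_group 3"

lemma group_braid_group: "group (braid_group n)"
  unfolding braid_group_def by (rule group_presented_group)


section \<open>The Hurwitz action\<close>

text \<open>Elements of \<open>G\<^sup>k\<close> are lists of length \<open>k\<close>, so that the \<open>i\<close>-th component (counted from 1)
  of \<open>xs\<close> is \<open>xs ! (i - 1)\<close>.\<close>

definition tuples :: "('g, 'm) monoid_scheme \<Rightarrow> nat \<Rightarrow> 'g list set" where
  "tuples G k = {xs. length xs = k \<and> set xs \<subseteq> carrier G}"

definition hurwitz_move :: "('g, 'm) monoid_scheme \<Rightarrow> nat \<Rightarrow> nat \<Rightarrow> 'g list \<Rightarrow> 'g list" where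
  "hurwitz_move G k i = (\<lambda>xs\<in>tuples G k.
     xs[i - 1 := xs ! (i - 1) \<otimes>\<^bsub>G\<^esub> xs ! i \<otimes>\<^bsub>G\<^esub> inv\<^bsub>G\<^esub> (xs ! (i - 1)), i := xs ! (i - 1)])"

definition hurwitz_action ::
    "('g, 'm) monoid_scheme \<Rightarrow> nat \<Rightarrow> braid \<Rightarrow> 'g list \<Rightarrow> 'g list" where
  "hurwitz_action G k = pres_hom (BijGroup (tuples G k)) (hurwitz_move G k)"

lemma tuples_nth: "xs \<in> tuples G k \<Longrightarrow> j < k \<Longrightarrow> xs ! j \<in> carrier G"
  by (auto simp: tuples_def)

lemma tuples_update:
  "xs \<in> tuples G k \<Longrightarrow> g \<in> carrier G \<Longrightarrow> xs[j := g] \<in> tuples G k"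
  using set_update_subset_insert[of xs j g] by (auto simp: tuples_def)

lemma (in group) inv_mult_cancel:
  assumes "a \<in> carrier G" "x \<in> carrier G"
  shows "inv a \<otimes> (a \<otimes> x) = x" "a \<otimes> (inv a \<otimes> x) = x"
  using assms m_assoc[of "inv a" a x] m_assoc[of a "inv a" x] by simp_all

lemma hurwitz_move_closed:
  assumes "group G" "1 \<le> i" "i < k" "xs \<in> tuples G k"
  shows "hurwitz_move G k i xs \<in> tuples G k"
proof -
  interpret group G by fact
  have "xs ! (i - 1) \<in> carrier G" "xs ! i \<in> carrier G"
    using assms by (auto intro: tuples_nth[OF assms(4)])
  then show ?thesis
    using assms(4) by (simp add: hurwitz_move_def tuples_update)
qed

lemma hurwitz_move_Bij:
  assumes "group G" "1 \<le> i" "i < k"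
  shows "hurwitz_move G k i \<in> Bij (tuples G k)"
proof -
  interpret group G by fact
  let ?T = "tuples G k"
  define b where
    "b = (\<lambda>ys. ys[i - 1 := ys ! i, i := inv\<^bsub>G\<^esub> (ys ! i) \<otimes>\<^bsub>G\<^esub> ys ! (i - 1) \<otimes>\<^bsub>G\<^esub> ys ! i])"
  have ik: "i - 1 < k" "i - 1 \<noteq> i" using assms by auto
  have "bij_betw (hurwitz_move G k i) ?T ?T"
  proof (rule bij_betw_byWitness[where f' = b])
    show "\<forall>xs\<in>?T. b (hurwitz_move G k i xs) = xs"
    proof
      fix xs assume xs: "xs \<in> ?T"
      have c: "xs ! i \<in> carrier G" "xs ! (i - 1) \<in> carrier G" "length xs = k"
        using tuples_nth[OF xs] assms ik xs by (auto simp: tuples_def)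
      show "b (hurwitz_move G k i xs) = xs"
        by (rule nth_equalityI)
          (use c assms ik xs in
            \<open>simp_all add: b_def hurwitz_move_def nth_list_update m_assoc inv_mult_cancel\<close>)
    qed
    show "\<forall>xs\<in>?T. hurwitz_move G k i (b xs) = xs"
    proof
      fix xs assume xs: "xs \<in> ?T"
      have c: "xs ! i \<in> carrier G" "xs ! (i - 1) \<in> carrier G" "length xs = k"
        using tuples_nth[OF xs] assms ik xs by (auto simp: tuples_def)
      have "b xs \<in> ?T"
        using xs c by (simp add: b_def tuples_update)
      moreover have "xs ! i \<otimes>\<^bsub>G\<^esub> (inv\<^bsub>G\<^esub> (xs ! i) \<otimes>\<^bsub>G\<^esub> xs ! (i - 1) \<otimes>\<^bsub>G\<^esub> xs ! i) \<otimes>\<^bsub>G\<^esub> inv\<^bsub>G\<^esub> (xs ! i) =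
          xs ! (i - 1)"
        using c by (simp add: m_assoc inv_mult_cancel)
      ultimately have "hurwitz_move G k i (b xs) = (b xs)[i - 1 := xs ! (i - 1), i := xs ! i]"
        using c assms(2,3) ik by (simp add: b_def hurwitz_move_def)
      then show "hurwitz_move G k i (b xs) = xs"
        using ik by (simp add: b_def list_update_swap)
    qed
    show "hurwitz_move G k i ` ?T \<subseteq> ?T"
      using hurwitz_move_closed[OF assms] by auto
    show "b ` ?T \<subseteq> ?T"
    proof
      fix ys assume "ys \<in> b ` ?T"
      then obtain xs where xs: "xs \<in> ?T" "ys = b xs" by blast
      have "xs ! i \<in> carrier G" "xs ! (i - 1) \<in> carrier G"
        using tuples_nth[OF xs(1)] assms ik by auto
      then show "ys \<in> ?T"
        using xs by (simp add: b_def tuples_update)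
    qed
  qed
  then show ?thesis
    by (simp add: Bij_def hurwitz_move_def)
qed

lemma hurwitz_move_nth:
  assumes "xs \<in> tuples G k" "1 \<le> i" "i < k" "j < k"
  shows "hurwitz_move G k i xs ! j =
    (if j = i then xs ! (i - 1)
     else if j = i - 1 then xs ! (i - 1) \<otimes>\<^bsub>G\<^esub> xs ! i \<otimes>\<^bsub>G\<^esub> inv\<^bsub>G\<^esub> (xs ! (i - 1)) else xs ! j)"
  using assms by (auto simp: hurwitz_move_def nth_list_update tuples_def)

lemma hurwitz_braid_relation:
  assumes "group G" "1 \<le> i" "Suc i < k" "xs \<in> tuples G k"
  defines "m \<equiv> hurwitz_move G k"
  shows "m i (m (Suc i) (m i xs)) = m (Suc i) (m i (m (Suc i) xs))"
proof -
  interpret group G by fact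
  note cl = hurwitz_move_closed[OF assms(1)]
  have len: "length ys = k" if "ys \<in> tuples G k" for ys
    using that by (simp add: tuples_def)
  have i: "i - 1 \<noteq> i" "i - 1 \<noteq> Suc i" "Suc i - 1 = i" "i - 1 < k" "i < k"
    using assms(2,3) by auto
  have c: "xs ! (i - 1) \<in> carrier G" "xs ! i \<in> carrier G" "xs ! Suc i \<in> carrier G"
    using tuples_nth[OF assms(4)] assms(2,3) by auto
  show ?thesis
    unfolding m_def
  proof (rule nth_equalityI)
    show "length (hurwitz_move G k i (hurwitz_move G k (Suc i) (hurwitz_move G k i xs))) =
        length (hurwitz_move G k (Suc i) (hurwitz_move G k i (hurwitz_move G k (Suc i) xs)))"
      using assms(2-4) by (simp add: cl len)
  next
    fix j assume "j < length (hurwitz_move G k i (hurwitz_move G k (Suc i) (hurwitz_move G k i xs)))"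
    then have j: "j < k"
      using assms(2-4) by (simp add: cl len)
    show "hurwitz_move G k i (hurwitz_move G k (Suc i) (hurwitz_move G k i xs)) ! j =
        hurwitz_move G k (Suc i) (hurwitz_move G k i (hurwitz_move G k (Suc i) xs)) ! j"
      using assms(2-4) i j c
      by (simp add: hurwitz_move_nth cl m_assoc inv_mult_group inv_mult_cancel)
  qed
qed

lemma hurwitz_far_commutation:
  assumes "group G" "1 \<le> i" "i + 2 \<le> j" "j < k" "xs \<in> tuples G k"
  defines "m \<equiv> hurwitz_move G k"
  shows "m i (m j xs) = m j (m i xs)"
proof -
  note cl = hurwitz_move_closed[OF assms(1)]
  have len: "length ys = k" if "ys \<in> tuples G k" for ys
    using that by (simp add: tuples_def)
  have i: "i - 1 \<noteq> i" "i - 1 \<noteq> j" "i - 1 \<noteq> j - 1" "i \<noteq> j" "i \<noteq> j - 1" "j - 1 \<noteq> j"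
    "i - 1 < k" "i < k" "j - 1 < k" "1 \<le> j"
    using assms(2-4) by auto
  show ?thesis
    unfolding m_def
    by (rule nth_equalityI) (use assms(2-5) i in \<open>auto simp: hurwitz_move_nth cl len\<close>)
qed

lemma BijGroup_mult_apply:
  assumes "f \<in> Bij T" "g \<in> Bij T" "x \<in> T"
  shows "(f \<otimes>\<^bsub>BijGroup T\<^esub> g) x = f (g x)"
  using assms by (simp add: BijGroup_def compose_def)

lemma hurwitz_respects_relations:
  assumes "group G" "(l, r) \<in> artin_relations k"
  shows "gword_eval (BijGroup (tuples G k)) (hurwitz_move G k) l =
         gword_eval (BijGroup (tuples G k)) (hurwitz_move G k) r"
proof -
  let ?T = "tuples G k" and ?m = "hurwitz_move G k"
  interpret BG: group "BijGroup ?T" by (rule group_BijGroup)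
  have car: "carrier (BijGroup ?T) = Bij ?T" by (simp add: BijGroup_def)
  have b: "?m i \<in> Bij ?T" if "1 \<le> i" "i < k" for i
    using hurwitz_move_Bij[OF assms(1) that] .
  have eqI: "f = g" if "f \<in> Bij ?T" "g \<in> Bij ?T" "\<And>x. x \<in> ?T \<Longrightarrow> f x = g x" for f g
    using that by (auto simp: Bij_def intro: extensionalityI)
  have cl: "f \<otimes>\<^bsub>BijGroup ?T\<^esub> g \<in> Bij ?T" if "f \<in> Bij ?T" "g \<in> Bij ?T" for f g
    using that BG.m_closed car by blast
  consider (braid) i where "1 \<le> i" "Suc i < k"
      "l = [(i, True), (Suc i, True), (i, True)]" "r = [(Suc i, True), (i, True), (Suc i, True)]"
    | (far) i j where "1 \<le> i" "i + 2 \<le> j" "j < k" "l = [(i, True), (j, True)]"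
      "r = [(j, True), (i, True)]"
    using assms(2) unfolding artin_relations_def by blast
  then show ?thesis
  proof cases
    case braid
    have bi: "?m i \<in> Bij ?T" "?m (Suc i) \<in> Bij ?T" using b braid by auto
    have mc: "?m i x \<in> ?T" "?m (Suc i) x \<in> ?T" if "x \<in> ?T" for x
      using hurwitz_move_closed[OF assms(1)] that braid by auto
    have "?m i \<otimes>\<^bsub>BijGroup ?T\<^esub> (?m (Suc i) \<otimes>\<^bsub>BijGroup ?T\<^esub> ?m i) =
        ?m (Suc i) \<otimes>\<^bsub>BijGroup ?T\<^esub> (?m i \<otimes>\<^bsub>BijGroup ?T\<^esub> ?m (Suc i))"
      by (rule eqI)
        (use bi mc cl hurwitz_braid_relation[OF assms(1) braid(1,2)] in
          \<open>simp_all add: BijGroup_mult_apply\<close>)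
    then show ?thesis
      using bi by (simp add: braid car)
  next
    case far
    have bi: "?m i \<in> Bij ?T" "?m j \<in> Bij ?T" using b far by auto
    have mc: "?m i x \<in> ?T" "?m j x \<in> ?T" if "x \<in> ?T" for x
      using hurwitz_move_closed[OF assms(1)] that far by auto
    have "?m i \<otimes>\<^bsub>BijGroup ?T\<^esub> ?m j = ?m j \<otimes>\<^bsub>BijGroup ?T\<^esub> ?m i"
      by (rule eqI)
        (use bi mc cl hurwitz_far_commutation[OF assms(1) far(1-3)] in
          \<open>simp_all add: BijGroup_mult_apply\<close>)
    then show ?thesis
      using bi by (simp add: far car)
  qed
qed

lemma hurwitz_move_carrier:
  "group G \<Longrightarrow> i \<in> {1..<k} \<Longrightarrow> hurwitz_move G k i \<in> carrier (BijGroup (tuples G k))"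
  using hurwitz_move_Bij[of G i k] by (simp add: BijGroup_def)

lemma hurwitz_group_action:
  assumes "group G"
  shows "group_action (braid_group k) (tuples G k) (hurwitz_action G k)"
  unfolding group_action_def hurwitz_action_def braid_group_def
  by (rule pres_hom_group_hom[OF group_BijGroup])
    (use assms in \<open>simp_all add: hurwitz_move_carrier hurwitz_respects_relations\<close>)

lemma hurwitz_action_gen:
  assumes "group G" "1 \<le> i" "i < k"
  shows "hurwitz_action G k (braid_gen k i) = hurwitz_move G k i"
  unfolding hurwitz_action_def braid_gen_def
  by (rule pres_hom_gen[OF group_BijGroup])
    (use assms in \<open>simp_all add: hurwitz_move_carrier hurwitz_respects_relations\<close>)


section \<open>Quasipositive braids with three strings\<close>

definition qp_factorization :: "braid \<Rightarrow> braid list \<Rightarrow> bool" where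
  "qp_factorization X xs \<longleftrightarrow>
     (\<forall>Y\<in>set xs. \<exists>g\<in>carrier B3. Y = g \<otimes>\<^bsub>B3\<^esub> braid_gen 3 1 \<otimes>\<^bsub>B3\<^esub> inv\<^bsub>B3\<^esub> g)
     \<and> foldr (\<otimes>\<^bsub>B3\<^esub>) xs \<one>\<^bsub>B3\<^esub> = X"

definition quasipositive :: "braid \<Rightarrow> bool" where
  "quasipositive X \<longleftrightarrow> (\<exists>xs. qp_factorization X xs)"

definition qp_factorizations :: "nat \<Rightarrow> braid \<Rightarrow> braid list set" where
  "qp_factorizations k X = {xs. length xs = k \<and> qp_factorization X xs}"

text \<open>BKL-positive words are lists over the following alphabet; \<open>bkl_word\<close> is the braid that
  such a word represents.\<close>

datatype bkl_letter = S0 | S1 | S2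

fun bkl_braid :: "bkl_letter \<Rightarrow> braid" where
  "bkl_braid S0 = inv\<^bsub>B3\<^esub> (braid_gen 3 1) \<otimes>\<^bsub>B3\<^esub> braid_gen 3 2 \<otimes>\<^bsub>B3\<^esub> braid_gen 3 1"
| "bkl_braid S1 = braid_gen 3 1"
| "bkl_braid S2 = braid_gen 3 2"

definition bkl_word :: "bkl_letter list \<Rightarrow> braid" where
  "bkl_word W = foldr (\<otimes>\<^bsub>B3\<^esub>) (map bkl_braid W) \<one>\<^bsub>B3\<^esub>"

definition bkl_delta :: braid where
  "bkl_delta = braid_gen 3 2 \<otimes>\<^bsub>B3\<^esub> braid_gen 3 1"

text \<open>
  Positions in a word are counted from 0, so index sets are subsets of \<open>{..<length W}\<close>.
  For \<open>i\<close> the \<open>j\<close>-th element of \<open>I\<close>, the prefix \<open>W\<^sub>1 \<cdots> W\<^sub>j\<close> consists of the letters of \<open>W\<close>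
  that stand before position \<open>i\<close> and whose positions are not in \<open>I\<close>.
\<close>

definition index_prefix :: "bkl_letter list \<Rightarrow> nat set \<Rightarrow> nat \<Rightarrow> bkl_letter list" where
  "index_prefix W I i = nths (take i W) (- I)"

definition index_tuple :: "bkl_letter list \<Rightarrow> nat set \<Rightarrow> braid list" where
  "index_tuple W I = map (\<lambda>i. bkl_word (index_prefix W I i) \<otimes>\<^bsub>B3\<^esub> bkl_braid (W ! i)
       \<otimes>\<^bsub>B3\<^esub> inv\<^bsub>B3\<^esub> (bkl_word (index_prefix W I i)))
     (sorted_list_of_set I)"

definition word_minimal :: "bkl_letter list \<Rightarrow> nat set \<Rightarrow> bool" where
  "word_minimal W I \<longleftrightarrow> \<not> (\<exists>i. i \<notin> I \<and> Suc i \<in> I \<and> W ! i = W ! Suc i)"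

lemma bkl_relations:
  "bkl_braid S2 \<otimes>\<^bsub>B3\<^esub> bkl_braid S1 = bkl_braid S1 \<otimes>\<^bsub>B3\<^esub> bkl_braid S0"
  "bkl_braid S1 \<otimes>\<^bsub>B3\<^esub> bkl_braid S0 = bkl_braid S0 \<otimes>\<^bsub>B3\<^esub> bkl_braid S2"
proof -
  interpret group B3 by (rule group_braid_group)
  let ?a = "braid_gen 3 1" and ?b = "braid_gen 3 2"
  have c: "?a \<in> carrier B3" "?b \<in> carrier B3"
    unfolding braid_gen_def braid_group_def by (auto intro!: pres_gen_closed)
  have "pres_eq {1..<3::nat} (artin_relations 3)
      ([] @ [(1, True), (Suc 1, True), (1, True)] @ []) ([] @ [(Suc 1, True), (1, True), (Suc 1, True)] @ [])"
    by (rule pres_eq.relator) (auto simp: artin_relations_def)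
  then have "pres_rel {1..<3} (artin_relations 3) `` {[(1, True), (2, True), (1, True)]} =
      pres_rel {1..<3} (artin_relations 3) `` {[(2, True), (1, True), (2, True)]}"
    by (intro equiv_class_eq[OF equiv_pres_rel]) (simp add: pres_rel_def numeral_2_eq_2)
  then have braid: "?a \<otimes>\<^bsub>B3\<^esub> (?b \<otimes>\<^bsub>B3\<^esub> ?a) = ?b \<otimes>\<^bsub>B3\<^esub> (?a \<otimes>\<^bsub>B3\<^esub> ?b)"
    unfolding braid_gen_def pres_gen_def braid_group_def
    by (simp add: pres_mult)
  have *: "inv\<^bsub>B3\<^esub> ?a \<otimes>\<^bsub>B3\<^esub> (?b \<otimes>\<^bsub>B3\<^esub> (?a \<otimes>\<^bsub>B3\<^esub> ?b)) = ?b \<otimes>\<^bsub>B3\<^esub> ?a"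
    unfolding braid[symmetric] using c by (simp add: inv_mult_cancel)
  show 1: "bkl_braid S2 \<otimes>\<^bsub>B3\<^esub> bkl_braid S1 = bkl_braid S1 \<otimes>\<^bsub>B3\<^esub> bkl_braid S0"
    using c by (simp add: m_assoc inv_mult_cancel)
  have "bkl_braid S0 \<otimes>\<^bsub>B3\<^esub> bkl_braid S2 = inv\<^bsub>B3\<^esub> ?a \<otimes>\<^bsub>B3\<^esub> (?b \<otimes>\<^bsub>B3\<^esub> (?a \<otimes>\<^bsub>B3\<^esub> ?b))"
    using c by (simp add: m_assoc)
  then show "bkl_braid S1 \<otimes>\<^bsub>B3\<^esub> bkl_braid S0 = bkl_braid S0 \<otimes>\<^bsub>B3\<^esub> bkl_braid S2"
    unfolding 1[symmetric] * by simp
qed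

end

theory Submission
  imports Defs
begin

text \<open>
  Mark the letters of a positive word \<open>V\<close> that an index set selects. The marks give a tuple of
  conjugates of letters (\<open>factors\<close>), and the tuple factorizes \<open>V \<delta>\<^sup>-\<^sup>q\<close> if the unmarked letters
  represent \<open>\<delta>\<^sup>q\<close>. The proof starts with some marked word for a given factorization and
  rewrites it into \<open>W\<close>; the marks follow, and the tuple changes only by Hurwitz moves.

  A starting word exists for trivial reasons (\<open>factors_surj\<close>): every factor is \<open>P y P\<^sup>-\<^sup>1\<close> for a
  positive word \<open>P\<close>, and \<open>P\<^sup>-\<^sup>1\<close> can be replaced by a positive word, because each letter divides
  \<open>\<delta>\<close> and a power of \<open>\<delta>\<close> can be moved through the rest of the word by rotating the
  alphabet. So there is a word \<open>V\<close> with \<open>V \<delta>\<^sup>p = W \<delta>\<^sup>q\<close>, and since the monoid of positive words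
  embeds into the braid group (\<open>bkl_steps_if_bkl_word_eq\<close>), the two sides are joined by steps
  that replace one spelling of \<open>\<delta>\<close> as a product of two letters by another.

  Such a step is harmless when both letters or none of them are marked. When one is marked, the
  unmarked letter \<open>r\<close> may not occur in the new spelling. Here the condition on the
  unmarked letters enters: they represent a power of \<open>\<delta>\<close>, so \<open>r\<close> has a partner \<open>y\<close> with which it
  forms a \<open>\<delta>\<close> across a power of \<open>\<delta>\<close> (\<open>balanced_partner\<close>). The marked neighbour of \<open>r\<close>
  also forms a \<open>\<delta>\<close> with \<open>r\<close>, so it is conjugate to \<open>y\<close> through the unmarked letters between them.
  Therefore \<open>y\<close> can take over the mark, which moves one factor across those between the two
  positions (\<open>exchange\<close>), and the pair becomes unmarked (\<open>half_marked_pair\<close>).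

  The same exchange clears the final letters \<open>\<delta>\<^sup>q\<close> of marks, which leaves marks on \<open>W\<close>
  alone, and applied to two equal neighbours it shifts a mark to the left until the
  index set is minimal.
\<close>

section \<open>Hurwitz equivalence of tuples\<close>

definition conjugate :: "('g, 'm) monoid_scheme \<Rightarrow> 'g \<Rightarrow> 'g \<Rightarrow> 'g" where
  "conjugate G g x = g \<otimes>\<^bsub>G\<^esub> x \<otimes>\<^bsub>G\<^esub> inv\<^bsub>G\<^esub> g"

lemma (in group) conjugate_closed [simp]:
  "g \<in> carrier G \<Longrightarrow> x \<in> carrier G \<Longrightarrow> conjugate G g x \<in> carrier G"
  by (simp add: conjugate_def)

lemma (in group) conjugate_one [simp]: "x \<in> carrier G \<Longrightarrow> conjugate G \<one> x = x"
  by (simp add: conjugate_def)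

lemma (in group) conjugate_mult:
  "g \<in> carrier G \<Longrightarrow> h \<in> carrier G \<Longrightarrow> x \<in> carrier G \<Longrightarrow>
    conjugate G (g \<otimes> h) x = conjugate G g (conjugate G h x)"
  by (simp add: conjugate_def m_assoc inv_mult_group)

lemma (in group) conjugate_eqI:
  "g \<in> carrier G \<Longrightarrow> x \<in> carrier G \<Longrightarrow> y \<in> carrier G \<Longrightarrow> g \<otimes> x = y \<otimes> g \<Longrightarrow> conjugate G g x = y"
  by (simp add: conjugate_def m_assoc)

lemma (in group) conjugate_mult_right:
  "g \<in> carrier G \<Longrightarrow> x \<in> carrier G \<Longrightarrow> conjugate G g x \<otimes> g = g \<otimes> x"
  by (simp add: conjugate_def m_assoc)

text \<open>
  A Hurwitz move does not depend on the place where it is applied, so it is described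
  through the two neighbours that it changes; the length of the tuple then becomes implicit.
\<close>

inductive hurwitz_step :: "('g, 'm) monoid_scheme \<Rightarrow> 'g list \<Rightarrow> 'g list \<Rightarrow> bool" for G where
  "x \<in> carrier G \<Longrightarrow> y \<in> carrier G \<Longrightarrow> hurwitz_step G (A @ [x, y] @ B) (A @ [conjugate G x y, x] @ B)"

abbreviation hurwitz_equiv :: "('g, 'm) monoid_scheme \<Rightarrow> 'g list \<Rightarrow> 'g list \<Rightarrow> bool" where
  "hurwitz_equiv G \<equiv> equivclp (hurwitz_step G)"

lemma hurwitz_equiv_trans:
  "hurwitz_equiv G xs ys \<Longrightarrow> hurwitz_equiv G ys zs \<Longrightarrow> hurwitz_equiv G xs zs"
  by (rule transpD[OF transp_equivclp])

lemma hurwitz_equiv_move: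
  "x \<in> carrier G \<Longrightarrow> y \<in> carrier G \<Longrightarrow>
    hurwitz_equiv G (A @ [x, y] @ B) (A @ [conjugate G x y, x] @ B)"
  by (intro r_into_equivclp hurwitz_step.intros)

lemma hurwitz_equiv_slide:
  assumes "x \<in> carrier G" "set ys \<subseteq> carrier G"
  shows "hurwitz_equiv G (A @ [x] @ ys @ B) (A @ map (conjugate G x) ys @ [x] @ B)"
  using assms(2)
proof (induction ys arbitrary: A)
  case Nil
  then show ?case by (simp add: equivclp_def)
next
  case (Cons y ys)
  have "hurwitz_equiv G (A @ [x] @ (y # ys) @ B) ((A @ [conjugate G x y]) @ [x] @ ys @ B)"
    using hurwitz_equiv_move[of x G y A "ys @ B"] Cons.prems assms(1) by simp
  moreover have "hurwitz_equiv G ((A @ [conjugate G x y]) @ [x] @ ys @ B)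
      ((A @ [conjugate G x y]) @ map (conjugate G x) ys @ [x] @ B)"
    using Cons.prems by (intro Cons.IH) simp
  ultimately show ?case
    using hurwitz_equiv_trans by fastforce
qed

text \<open>
  An orbit also contains the preimages of its elements under a move, because the braid group
  contains inverses; hence the symmetric closure of the moves does not leave the orbit.
\<close>

lemma hurwitz_equiv_orbit:
  assumes "group G" "hurwitz_equiv G xs ys" "xs \<in> tuples G k"
  shows "ys \<in> orbit (braid_group k) (hurwitz_action G k) xs"
proof -
  interpret act: group_action "braid_group k" "tuples G k" "hurwitz_action G k"
    by (rule hurwitz_group_action[OF assms(1)])
  have move: "zs \<in> orbit (braid_group k) (hurwitz_action G k) ys \<and> zs \<in> tuples G k"
    if st: "hurwitz_step G ys zs" and ys: "ys \<in> tuples G k" for ys zs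
    using st
  proof cases
    case (1 x y A B)
    let ?i = "Suc (length A)"
    have i: "1 \<le> ?i" "?i < k" using ys 1 by (auto simp: tuples_def)
    have "hurwitz_action G k (braid_gen k ?i) ys = hurwitz_move G k ?i ys"
      using hurwitz_action_gen[OF assms(1) i] by simp
    also have "\<dots> = zs"
      using ys by (simp add: hurwitz_move_def 1 conjugate_def nth_append list_update_append)
    finally have "hurwitz_action G k (braid_gen k ?i) ys = zs" .
    moreover have "braid_gen k ?i \<in> carrier (braid_group k)"
      unfolding braid_gen_def braid_group_def using i by (intro pres_gen_closed) auto
    moreover have "zs \<in> tuples G k"
      using hurwitz_move_closed[OF assms(1) i ys] calculation(1)
        hurwitz_action_gen[OF assms(1) i] by simp
    ultimately show ?thesis
      unfolding orbit_def by blast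
  qed
  have "ys \<in> orbit (braid_group k) (hurwitz_action G k) xs \<and> ys \<in> tuples G k"
    using assms(2)
  proof (induction rule: equivclp_induct)
    case base
    then show ?case using act.orbit_refl assms(3) by blast
  next
    case (step y z)
    have "length z = length y \<and> (set z \<subseteq> carrier G \<longleftrightarrow> set y \<subseteq> carrier G)"
      using step.hyps(2)
    proof (elim disjE)
      assume "hurwitz_step G y z"
      then show ?thesis
        by cases (use group.conjugate_closed[OF assms(1)] in auto)
    next
      assume "hurwitz_step G z y"
      then show ?thesis
        by cases (use group.conjugate_closed[OF assms(1)] in auto)
    qed
    then have z: "z \<in> tuples G k" using step.IH by (auto simp: tuples_def)
    have "z \<in> orbit (braid_group k) (hurwitz_action G k) y"
      using step.hyps(2) move act.orbit_sym z step.IH by blast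
    then show ?case
      using act.orbit_trans[OF assms(3) _ z] step.IH z by blast
  qed
  then show ?thesis ..
qed

section \<open>The Birman--Ko--Lee generators\<close>

interpretation B3: group B3
  by (rule group_braid_group)

abbreviation braid_mult (infixl "\<cdot>" 70) where
  "x \<cdot> y \<equiv> x \<otimes>\<^bsub>B3\<^esub> y"

abbreviation delta_power :: "nat \<Rightarrow> braid" where
  "delta_power n \<equiv> bkl_delta [^]\<^bsub>B3\<^esub> n"

text \<open>
  Both basic relations have the same shape when they are written with this rotation of the
  alphabet: the words for \<open>\<delta>\<close> are the words \<open>x (turn x)\<close>, and conjugation by \<open>\<delta>\<close> is \<open>turn\<close>.
\<close>

fun turn :: "bkl_letter \<Rightarrow> bkl_letter" where
  "turn S0 = S2"
| "turn S1 = S0"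
| "turn S2 = S1"

lemma turn_turn_turn [simp]: "turn (turn (turn x)) = x"
  by (cases x) auto

lemma turn_inject [simp]: "turn x = turn y \<longleftrightarrow> x = y"
  by (cases x; cases y) auto

lemma turn_pow_turn: "(turn ^^ n) (turn x) = turn ((turn ^^ n) x)"
  by (simp add: funpow_swap1)

lemma turn_pow_surj: "\<exists>y. (turn ^^ n) y = x"
proof (induction n)
  case (Suc n)
  then obtain y where "(turn ^^ n) y = x" by blast
  then have "(turn ^^ Suc n) (turn (turn y)) = x"
    by (simp add: turn_pow_turn)
  then show ?case by blast
qed simp

lemma bkl_braid_closed [simp]: "bkl_braid x \<in> carrier B3"
proof -
  have "braid_gen 3 1 \<in> carrier B3" "braid_gen 3 2 \<in> carrier B3"
    unfolding braid_gen_def braid_group_def by (auto intro!: pres_gen_closed)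
  then show ?thesis by (cases x) auto
qed

declare bkl_braid.simps [simp del]

lemma bkl_braid_turn: "bkl_braid x \<cdot> bkl_braid (turn x) = bkl_delta"
proof -
  have "bkl_braid S2 \<cdot> bkl_braid S1 = bkl_delta"
    by (simp only: bkl_delta_def bkl_braid.simps)
  then show ?thesis
    using bkl_relations by (cases x) simp_all
qed

lemma bkl_delta_closed [simp]: "bkl_delta \<in> carrier B3"
  unfolding bkl_braid_turn[of S1, symmetric] by (intro B3.m_closed bkl_braid_closed)

lemma delta_bkl_braid: "bkl_delta \<cdot> bkl_braid x = bkl_braid (turn x) \<cdot> bkl_delta"
proof -
  have "bkl_delta \<cdot> bkl_braid x
      = bkl_braid (turn x) \<cdot> (bkl_braid (turn (turn x)) \<cdot> bkl_braid x)"
    unfolding bkl_braid_turn[of "turn x", symmetric] by (simp add: B3.m_assoc)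
  also have "bkl_braid (turn (turn x)) \<cdot> bkl_braid x = bkl_delta"
    using bkl_braid_turn[of "turn (turn x)"] by simp
  finally show ?thesis .
qed

lemma delta_power_bkl_braid:
  "delta_power n \<cdot> bkl_braid x = bkl_braid ((turn ^^ n) x) \<cdot> delta_power n"
proof (induction n arbitrary: x)
  case (Suc n)
  have "delta_power (Suc n) \<cdot> bkl_braid x = delta_power n \<cdot> bkl_braid (turn x) \<cdot> bkl_delta"
    by (simp add: B3.m_assoc delta_bkl_braid)
  also have "\<dots> = bkl_braid ((turn ^^ n) (turn x)) \<cdot> delta_power (Suc n)"
    by (simp add: Suc B3.m_assoc)
  finally show ?case by (simp add: funpow_swap1)
qed simp

lemma bkl_word_Nil [simp]: "bkl_word [] = \<one>\<^bsub>B3\<^esub>"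
  and bkl_word_Cons [simp]: "bkl_word (x # W) = bkl_braid x \<cdot> bkl_word W"
  by (simp_all add: bkl_word_def)

lemma bkl_word_closed [simp]: "bkl_word W \<in> carrier B3"
  by (induction W) simp_all

lemma bkl_word_append [simp]: "bkl_word (U @ V) = bkl_word U \<cdot> bkl_word V"
  by (induction U) (simp_all add: B3.m_assoc)

lemma delta_power_bkl_word:
  "delta_power n \<cdot> bkl_word W = bkl_word (map (turn ^^ n) W) \<cdot> delta_power n"
proof (induction W)
  case (Cons x W)
  have "delta_power n \<cdot> bkl_word (x # W) = bkl_braid ((turn ^^ n) x) \<cdot> (delta_power n \<cdot> bkl_word W)"
    by (simp add: B3.m_assoc[symmetric] delta_power_bkl_braid)
  then show ?case by (simp add: Cons B3.m_assoc)
qed simp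

definition delta_word :: "nat \<Rightarrow> bkl_letter list" where
  "delta_word n = concat (replicate n [S2, S1])"

lemma delta_word_simps [simp]:
  "delta_word 0 = []" "delta_word (Suc n) = S2 # S1 # delta_word n"
  by (simp_all add: delta_word_def)

lemma delta_word_add: "delta_word (m + n) = delta_word m @ delta_word n"
  by (induction m) simp_all

lemma bkl_word_delta_word [simp]: "bkl_word (delta_word n) = delta_power n"
proof (induction n)
  case (Suc n)
  have "bkl_word (delta_word (Suc n)) = bkl_braid S2 \<cdot> bkl_braid (turn S2) \<cdot> delta_power n"
    by (simp add: Suc B3.m_assoc)
  then show ?case
    using B3.nat_pow_mult[of bkl_delta 1 n] unfolding bkl_braid_turn by simp
qed simp

section \<open>Marked words\<close>

text \<open>
  A pair of a word and a set of positions is stored as a list of letters with a mark, because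
  the rewriting below cuts and rebuilds both together. The argument \<open>g\<close> of \<open>factors\<close> is the
  braid of the unmarked letters that were already read.
\<close>

type_synonym marked_word = "(bkl_letter \<times> bool) list"

definition unmarked :: "marked_word \<Rightarrow> bkl_letter list" where
  "unmarked m = map fst (filter (\<lambda>p. \<not> snd p) m)"

fun factors :: "braid \<Rightarrow> marked_word \<Rightarrow> braid list" where
  "factors g [] = []"
| "factors g ((x, b) # m) =
    (if b then conjugate B3 g (bkl_braid x) # factors g m else factors (g \<cdot> bkl_braid x) m)"

lemma unmarked_simps [simp]:
  "unmarked [] = []"
  "unmarked ((x, b) # m) = (if b then unmarked m else x # unmarked m)"
  "unmarked (m @ m') = unmarked m @ unmarked m'"
  by (simp_all add: unmarked_def)

lemma factors_closed: "g \<in> carrier B3 \<Longrightarrow> set (factors g m) \<subseteq> carrier B3"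
  by (induction g m rule: factors.induct) auto

lemma factors_append:
  "g \<in> carrier B3 \<Longrightarrow> factors g (m @ m') = factors g m @ factors (g \<cdot> bkl_word (unmarked m)) m'"
  by (induction g m rule: factors.induct) (auto simp: B3.m_assoc)

lemma factors_conjugate:
  assumes "x \<in> carrier B3" "g \<in> carrier B3"
  shows "factors (x \<cdot> g) m = map (conjugate B3 x) (factors g m)"
  using assms(2)
  by (induction g m rule: factors.induct) (use assms(1) in \<open>auto simp: B3.m_assoc B3.conjugate_mult\<close>)

lemma factors_unmarked: "factors g (map (\<lambda>x. (x, False)) W) = []"
  by (induction W arbitrary: g) auto

lemma unmarked_unmarked: "unmarked (map (\<lambda>x. (x, False)) W) = W"
  by (induction W) auto

lemma foldr_mult_closed: "set xs \<subseteq> carrier B3 \<Longrightarrow> foldr (\<otimes>\<^bsub>B3\<^esub>) xs \<one>\<^bsub>B3\<^esub> \<in> carrier B3"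
  by (induction xs) auto

text \<open>A marked letter leaves \<open>g x = (g x g\<^sup>-\<^sup>1) g\<close>: the conjugates collect on the left of the unmarked letters.\<close>

lemma prod_factors:
  assumes "g \<in> carrier B3"
  shows "g \<cdot> bkl_word (map fst m) = foldr (\<otimes>\<^bsub>B3\<^esub>) (factors g m) \<one>\<^bsub>B3\<^esub> \<cdot> (g \<cdot> bkl_word (unmarked m))"
  using assms
proof (induction g m rule: factors.induct)
  case (2 g x b m)
  have P: "foldr (\<otimes>\<^bsub>B3\<^esub>) (factors h m) \<one>\<^bsub>B3\<^esub> \<in> carrier B3" if "h \<in> carrier B3" for h
    using factors_closed[OF that] by (rule foldr_mult_closed)
  show ?case
  proof (cases b)
    case True
    have "g \<cdot> bkl_word (map fst ((x, b) # m))
        = conjugate B3 g (bkl_braid x) \<cdot> g \<cdot> bkl_word (map fst m)"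
      using 2 by (simp add: B3.conjugate_mult_right B3.m_assoc)
    also have "\<dots> = conjugate B3 g (bkl_braid x) \<cdot> (g \<cdot> bkl_word (map fst m))"
      using 2 by (simp add: B3.m_assoc)
    also have "\<dots> = conjugate B3 g (bkl_braid x) \<cdot>
        (foldr (\<otimes>\<^bsub>B3\<^esub>) (factors g m) \<one>\<^bsub>B3\<^esub> \<cdot> (g \<cdot> bkl_word (unmarked m)))"
      using 2 True by simp
    finally show ?thesis
      using 2 True P by (simp add: B3.m_assoc)
  next
    case False
    have "g \<cdot> bkl_braid x \<cdot> bkl_word (map fst m) = foldr (\<otimes>\<^bsub>B3\<^esub>) (factors (g \<cdot> bkl_braid x) m) \<one>\<^bsub>B3\<^esub>
        \<cdot> (g \<cdot> bkl_braid x \<cdot> bkl_word (unmarked m))"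
      using 2 False by simp
    then show ?thesis
      using 2 False by (simp add: B3.m_assoc)
  qed
qed simp

section \<open>Positive words that are equal as braids\<close>

inductive bkl_step :: "bkl_letter list \<Rightarrow> bkl_letter list \<Rightarrow> bool" where
  "bkl_step (U @ [x, turn x] @ V) (U @ [y, turn y] @ V)"

lemma bkl_step_append:
  assumes "bkl_step U V"
  shows "bkl_step (A @ U @ B) (A @ V @ B)"
  using assms
proof cases
  case (1 C x D y)
  then show ?thesis using bkl_step.intros[of "A @ C" x "D @ B" y] by simp
qed

lemma bkl_steps_append:
  assumes "bkl_step\<^sup>*\<^sup>* U V"
  shows "bkl_step\<^sup>*\<^sup>* (A @ U @ B) (A @ V @ B)"
  using assms
proof (induction rule: rtranclp_induct)
  case (step V W)
  then show ?case by (meson bkl_step_append rtranclp.rtrancl_into_rtrancl)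
qed simp

lemma bkl_steps_sym: "bkl_step\<^sup>*\<^sup>* U V \<Longrightarrow> bkl_step\<^sup>*\<^sup>* V U"
proof -
  have "symp bkl_step"
    by (rule sympI) (metis bkl_step.cases bkl_step.intros)
  then show "bkl_step\<^sup>*\<^sup>* U V \<Longrightarrow> bkl_step\<^sup>*\<^sup>* V U"
    using symp_rtranclp sympD by metis
qed

text \<open>
  The pair \<open>(w, n)\<close> stands for \<open>w \<delta>\<^sup>n\<close>, and \<open>left_mult x\<close> for multiplication by \<open>x\<close> from the left:
  if \<open>x\<close> and the first letter of \<open>w\<close> form \<open>\<delta>\<close>, this \<open>\<delta>\<close> moves through the rest of \<open>w\<close> to the
  right end.
\<close>

type_synonym normal_form = "bkl_letter list \<times> int"

definition normal_forms :: "normal_form set" where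
  "normal_forms = {(w, n). successively (\<lambda>x y. y \<noteq> turn x) w}"

fun left_mult :: "bkl_letter \<Rightarrow> normal_form \<Rightarrow> normal_form" where
  "left_mult x ([], n) = ([x], n)"
| "left_mult x (y # w, n) = (if y = turn x then (map turn w, n + 1) else (x # y # w, n))"

fun delta_mult :: "normal_form \<Rightarrow> normal_form" where
  "delta_mult (w, n) = (map turn w, n + 1)"

lemma normal_forms_map_turn:
  "successively (\<lambda>x y. y \<noteq> turn x) (map turn w) \<longleftrightarrow> successively (\<lambda>x y. y \<noteq> turn x) w"
  by (simp add: successively_map)

lemma left_mult_closed: "s \<in> normal_forms \<Longrightarrow> left_mult x s \<in> normal_forms"
  by (induction x s rule: left_mult.induct)
    (auto simp: normal_forms_def normal_forms_map_turn successively_Cons)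

lemma delta_mult_closed: "s \<in> normal_forms \<Longrightarrow> delta_mult s \<in> normal_forms"
  by (cases s) (auto simp: normal_forms_def normal_forms_map_turn)

text \<open>
  If \<open>turn x\<close> cancels the first letter of the word, then \<open>x\<close> must not cancel the letter that
  comes next. This is where the word has to be reduced.
\<close>

lemma left_mult_turn:
  assumes "s \<in> normal_forms"
  shows "left_mult x (left_mult (turn x) s) = delta_mult s"
proof -
  obtain w n where s: "s = (w, n)" by (cases s)
  show ?thesis
  proof (cases w)
    case (Cons y t)
    then show ?thesis
      using assms by (cases t) (auto simp: s normal_forms_def)
  qed (simp add: s)
qed

lemma delta_mult_left_mult: "delta_mult (left_mult x s) = left_mult (turn x) (delta_mult s)"
  by (induction x s rule: left_mult.induct) auto

lemma delta_mult_bij: "bij_betw delta_mult normal_forms normal_forms"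
proof (rule bij_betw_byWitness[where f' = "\<lambda>(w, n). (map (turn \<circ> turn) w, n - 1)"])
  have t: "turn \<circ> (turn \<circ> turn) = id" "turn \<circ> turn \<circ> turn = id" by auto
  show "\<forall>s\<in>normal_forms. (case delta_mult s of (w, n) \<Rightarrow> (map (turn \<circ> turn) w, n - 1)) = s"
    using t by auto
  show "\<forall>s\<in>normal_forms. delta_mult (case s of (w, n) \<Rightarrow> (map (turn \<circ> turn) w, n - 1)) = s"
    using t by auto
  show "delta_mult ` normal_forms \<subseteq> normal_forms"
    using delta_mult_closed by blast
  show "(\<lambda>(w, n). (map (turn \<circ> turn) w, n - 1)) ` normal_forms \<subseteq> normal_forms"
    by (auto simp: normal_forms_def normal_forms_map_turn simp flip: map_map)
qed

lemma left_mult_inj: "inj_on (left_mult x) normal_forms"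
proof -
  have "inj_on (\<lambda>s. left_mult (turn (turn x)) (left_mult (turn (turn (turn x))) s)) normal_forms"
    using bij_betw_imp_inj_on[OF delta_mult_bij]
    by (subst inj_on_cong[OF left_mult_turn])
  then show ?thesis
    by (auto simp: inj_on_def)
qed

lemma left_mult_bij: "bij_betw (left_mult x) normal_forms normal_forms"
  unfolding bij_betw_def
proof (intro conjI left_mult_inj equalityI subsetI)
  fix s assume "s \<in> left_mult x ` normal_forms"
  then show "s \<in> normal_forms"
    by (elim imageE) (simp add: left_mult_closed)
next
  fix s assume "s \<in> normal_forms"
  then have "s \<in> delta_mult ` normal_forms"
    by (simp only: bij_betw_imp_surj_on[OF delta_mult_bij])
  then obtain r where "s = delta_mult r" "r \<in> normal_forms"
    by (rule imageE)
  then show "s \<in> left_mult x ` normal_forms"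
    by (intro image_eqI[of _ _ "left_mult (turn x) r"]) (simp_all only: left_mult_turn left_mult_closed)
qed

definition left_mult_gen :: "nat \<Rightarrow> normal_form \<Rightarrow> normal_form" where
  "left_mult_gen i = restrict (left_mult (if i = 1 then S1 else S2)) normal_forms"

lemma left_mult_gen_Bij: "left_mult_gen i \<in> Bij normal_forms"
  using left_mult_bij by (simp add: left_mult_gen_def Bij_def bij_betw_restrict_eq)

lemma left_mult_gen_carrier: "left_mult_gen i \<in> carrier (BijGroup normal_forms)"
  using left_mult_gen_Bij by (simp add: BijGroup_def)

lemma left_mult_gen_braid_relation:
  fixes l r :: "nat gword"
  assumes "(l, r) \<in> artin_relations 3"
  shows "gword_eval (BijGroup normal_forms) left_mult_gen l =
    gword_eval (BijGroup normal_forms) left_mult_gen r"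
proof -
  let ?G = "BijGroup normal_forms"
  interpret BG: group ?G by (rule group_BijGroup)
  have cl: "f \<otimes>\<^bsub>?G\<^esub> g \<in> Bij normal_forms" if "f \<in> Bij normal_forms" "g \<in> Bij normal_forms" for f g
    using that BG.m_closed by (simp add: BijGroup_def)
  have rel: "left_mult_gen 1 \<otimes>\<^bsub>?G\<^esub> (left_mult_gen 2 \<otimes>\<^bsub>?G\<^esub> left_mult_gen 1) =
      left_mult_gen 2 \<otimes>\<^bsub>?G\<^esub> (left_mult_gen 1 \<otimes>\<^bsub>?G\<^esub> left_mult_gen 2)" (is "?f = ?g")
  proof (rule extensionalityI[of _ normal_forms])
    show "?f \<in> extensional normal_forms" "?g \<in> extensional normal_forms"
      using cl left_mult_gen_Bij by (auto simp: Bij_def)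
    fix s assume s: "s \<in> normal_forms"
    have gen: "left_mult_gen i t \<in> normal_forms" if "t \<in> normal_forms" for i t
      using that by (simp add: left_mult_gen_def left_mult_closed)
    have "?f s = left_mult S1 (left_mult S2 (left_mult S1 s))"
      "?g s = left_mult S2 (left_mult S1 (left_mult S2 s))"
      using s by (simp_all only: BijGroup_mult_apply cl left_mult_gen_Bij gen)
        (simp_all add: left_mult_gen_def left_mult_closed)
    then show "?f s = ?g s"
      using left_mult_turn[of s S2] left_mult_turn[of "left_mult S2 s" S2]
        left_mult_turn[of "left_mult S1 s" S2]
        delta_mult_left_mult[of S2 s] left_mult_closed[OF s] s by simp
  qed
  have "l = [(1, True), (2, True), (1, True)] \<and> r = [(2, True), (1, True), (2, True)]"
    using assms by (auto simp: artin_relations_def numeral_2_eq_2)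
  then show ?thesis
    using rel left_mult_gen_carrier by simp
qed

text \<open>
  The braid group acts on normal forms. Hence a braid determines the normal form of each
  positive word that represents it, which makes the normal form unique.
\<close>

lemma left_mult_group_hom:
  "group_hom B3 (BijGroup normal_forms) (pres_hom (BijGroup normal_forms) left_mult_gen)"
  unfolding braid_group_def
  by (intro pres_hom_group_hom group_BijGroup left_mult_gen_carrier left_mult_gen_braid_relation)

lemma foldr_left_mult_closed: "s \<in> normal_forms \<Longrightarrow> foldr left_mult W s \<in> normal_forms"
  by (induction W) (auto simp: left_mult_closed)

lemma foldr_left_mult_eq:
  assumes "bkl_word V = bkl_word W" "s \<in> normal_forms"
  shows "foldr left_mult V s = foldr left_mult W s"
proof -
  let ?G = "BijGroup normal_forms"
  define \<phi> where "\<phi> = pres_hom ?G left_mult_gen"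
  interpret group_hom B3 ?G \<phi>
    unfolding \<phi>_def by (rule left_mult_group_hom)
  have Bij: "\<phi> g \<in> Bij normal_forms" if "g \<in> carrier B3" for g
    using hom_closed[OF that] by (simp add: BijGroup_def)
  have nf: "\<phi> g s \<in> normal_forms" if "g \<in> carrier B3" "s \<in> normal_forms" for g s
    using Bij[OF that(1)] that(2) by (auto simp: Bij_def bij_betw_def)
  have mult: "\<phi> (g \<cdot> h) s = \<phi> g (\<phi> h s)"
    if "g \<in> carrier B3" "h \<in> carrier B3" "s \<in> normal_forms" for g h s
    using that Bij by (simp add: BijGroup_mult_apply)
  have gen: "\<phi> (braid_gen 3 i) = left_mult_gen i" if "i \<in> {1, 2}" for i
    unfolding \<phi>_def braid_gen_def
    by (intro pres_hom_gen group_BijGroup left_mult_gen_carrier left_mult_gen_braid_relation)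
      (use that in auto)
  have 12: "\<phi> (bkl_braid S1) s = left_mult S1 s" "\<phi> (bkl_braid S2) s = left_mult S2 s"
    if "s \<in> normal_forms" for s
    using that gen[of 1] gen[of 2] by (simp_all add: bkl_braid.simps left_mult_gen_def)
  have 0: "\<phi> (bkl_braid S0) s = left_mult S0 s" if "s \<in> normal_forms" for s
  proof -
    have "left_mult S1 (\<phi> (bkl_braid S0) s) = \<phi> (bkl_braid S1 \<cdot> bkl_braid (turn S1)) s"
      using that by (simp add: mult 12 nf del: hom_mult)
    also have "\<dots> = \<phi> (bkl_braid S2 \<cdot> bkl_braid (turn S2)) s"
      by (simp only: bkl_braid_turn)
    also have "\<dots> = left_mult S1 (left_mult S0 s)"
      using that left_mult_turn[OF that, of S1] left_mult_turn[OF that, of S2]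
      by (simp add: mult 12 nf left_mult_closed del: hom_mult)
    finally show ?thesis
      using left_mult_inj[of S1] that nf left_mult_closed by (simp add: inj_on_eq_iff)
  qed
  have letter: "\<phi> (bkl_braid x) s = left_mult x s" if "s \<in> normal_forms" for x s
    using 12 0 that by (cases x) auto
  have "\<phi> (bkl_word U) s = foldr left_mult U s" for U
  proof (induction U)
    case Nil
    then show ?case using assms(2) by (simp add: BijGroup_def)
  next
    case (Cons x U)
    then show ?case
      using assms(2) by (simp add: mult letter foldr_left_mult_closed del: hom_mult)
  qed
  then show ?thesis
    using assms(1) by metis
qed

lemma bkl_steps_delta: "bkl_step\<^sup>*\<^sup>* ([x, turn x] @ W) (map turn W @ [y, turn y])"
proof (induction W arbitrary: x)
  case Nil
  then show ?case using bkl_step.intros[of "[]" x "[]" y] by auto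
next
  case (Cons z W)
  have "bkl_step ([x, turn x] @ z # W) ([turn z, turn (turn z)] @ z # W)"
    using bkl_step.intros[of "[]" x "z # W" "turn z"] by simp
  moreover have "bkl_step\<^sup>*\<^sup>* ([turn z] @ ([turn (turn z), turn (turn (turn z))] @ W) @ [])
      ([turn z] @ (map turn W @ [y, turn y]) @ [])"
    using Cons by (rule bkl_steps_append)
  ultimately show ?case
    by (simp add: converse_rtranclp_into_rtranclp)
qed

lemma bkl_steps_normal_form:
  "\<exists>n. snd (foldr left_mult W ([], 0)) = int n \<and>
    bkl_step\<^sup>*\<^sup>* W (fst (foldr left_mult W ([], 0)) @ delta_word n)"
proof (induction W)
  case Nil
  show ?case by (intro exI[of _ 0]) simp
next
  case (Cons x W)
  obtain w k where s: "foldr left_mult W ([], 0) = (w, k)" by fastforce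
  obtain n where n: "k = int n" "bkl_step\<^sup>*\<^sup>* W (w @ delta_word n)"
    using Cons s by auto
  have st: "bkl_step\<^sup>*\<^sup>* (x # W) (x # w @ delta_word n)"
    using bkl_steps_append[OF n(2), of "[x]" "[]"] by simp
  show ?case
  proof (cases "\<exists>t. w = turn x # t")
    case True
    then obtain t where t: "w = turn x # t" by blast
    have "bkl_step\<^sup>*\<^sup>* ([] @ ([x, turn x] @ t) @ delta_word n)
        ([] @ (map turn t @ [S2, turn S2]) @ delta_word n)"
      by (intro bkl_steps_append bkl_steps_delta)
    then have "bkl_step\<^sup>*\<^sup>* (x # W) (map turn t @ delta_word (Suc n))"
      using st t by simp
    then show ?thesis
      using s t n(1) by (intro exI[of _ "Suc n"]) simp
  next
    case False
    then have "left_mult x (w, k) = (x # w, k)" by (cases w) auto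
    then show ?thesis
      using s n(1) st by (intro exI[of _ n]) simp
  qed
qed

lemma empty_normal_form: "([], 0) \<in> normal_forms"
  by (simp add: normal_forms_def)

text \<open>Both words can be rewritten into their normal forms, which coincide because the braids do.\<close>

theorem bkl_steps_if_bkl_word_eq:
  assumes "bkl_word V = bkl_word W"
  shows "bkl_step\<^sup>*\<^sup>* V W"
proof -
  have *: "foldr left_mult V ([], 0) = foldr left_mult W ([], 0)"
    using assms empty_normal_form by (rule foldr_left_mult_eq)
  obtain m where m: "snd (foldr left_mult V ([], 0)) = int m"
    "bkl_step\<^sup>*\<^sup>* V (fst (foldr left_mult V ([], 0)) @ delta_word m)"
    using bkl_steps_normal_form by blast
  obtain n where n: "snd (foldr left_mult W ([], 0)) = int n"
    "bkl_step\<^sup>*\<^sup>* W (fst (foldr left_mult W ([], 0)) @ delta_word n)"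
    using bkl_steps_normal_form by blast
  have "m = n" using m(1) n(1) * by simp
  then show ?thesis
    using m(2) bkl_steps_sym[OF n(2)] * by simp
qed

lemma foldr_left_mult_delta_word: "foldr left_mult (delta_word n) ([], 0) = ([], int n)"
  by (induction n) auto

section \<open>Partners in words that represent a power of delta\<close>

text \<open>
  Words of the form \<open>\<delta>\<^sup>m\<close> are built like words of balanced parentheses: each letter cancels
  against exactly one partner, and the letters between both form a power of \<open>\<delta>\<close> again.
\<close>

inductive balanced :: "nat \<Rightarrow> bkl_letter list \<Rightarrow> bool" where
  Nil: "balanced 0 []"
| pair: "balanced m U \<Longrightarrow> balanced n V \<Longrightarrow> (turn ^^ m) y = turn x \<Longrightarrow>
    balanced (Suc (m + n)) (x # U @ y # V)"

text \<open>
  The second argument consists of the letters of an arbitrary word that remain without a partner,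
  rotated into the normal form of the word.
\<close>

inductive parse :: "bkl_letter list \<Rightarrow> bkl_letter list \<Rightarrow> nat \<Rightarrow> bool" where
  Nil: "balanced n U \<Longrightarrow> parse U [] n"
| Cons: "balanced n U \<Longrightarrow> parse V w m \<Longrightarrow> parse (U @ x # V) (map (turn ^^ n) (x # w)) (n + m)"

text \<open>
  A new first letter stays without a partner unless it forms a \<open>\<delta>\<close> with the first unpaired
  letter; in this case the pair and the balanced words around it merge into one.
\<close>

lemma parse_Cons:
  assumes "parse W w n"
  shows "\<exists>v k. parse (x # W) v k \<and> left_mult x (w, int n) = (v, int k)"
  using assms
proof cases
  case Nil
  have "parse ([] @ x # W) (map (turn ^^ 0) (x # [])) (0 + n)"
    using Nil by (intro parse.intros balanced.Nil) simp
  then show ?thesis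
    using Nil by auto
next
  case (Cons k U V v m y)
  show ?thesis
  proof (cases "(turn ^^ k) y = turn x")
    case y: True
    from \<open>parse V v m\<close> show ?thesis
    proof cases
      case Nil
      have "balanced (Suc (k + m)) (x # U @ y # V)"
        using Cons Nil y by (intro balanced.pair) auto
      then show ?thesis
        using Cons Nil y by (auto intro!: parse.Nil)
    next
      case (Cons l A B u j z)
      note C = this
      have "balanced (Suc (k + l)) (x # U @ y # A)"
        using \<open>balanced k U\<close> C y by (intro balanced.pair) auto
      then have "parse ((x # U @ y # A) @ z # B) (map (turn ^^ Suc (k + l)) (z # u)) (Suc (k + l) + j)"
        using C by (intro parse.Cons)
      moreover have "map (turn ^^ Suc (k + l)) (z # u) = map turn (map (turn ^^ k) v)"
        using C by (simp add: funpow_add)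
      ultimately have "parse (x # W) (map turn (map (turn ^^ k) v)) (Suc (k + l) + j)"
        using \<open>W = _\<close> C(1) by (simp only: append_Cons append_assoc)
      moreover have "left_mult x (w, int n) = (map turn (map (turn ^^ k) v), int (Suc (k + l) + j))"
        using \<open>w = _\<close> \<open>n = _\<close> C(3) y by simp
      ultimately show ?thesis
        by blast
    qed
  next
    case False
    have "parse ([] @ x # W) (map (turn ^^ 0) (x # w)) (0 + n)"
      using assms by (intro parse.intros balanced.Nil)
    then show ?thesis
      using False Cons by (intro exI[of _ "x # w"] exI[of _ n]) auto
  qed
qed

lemma parse_foldr_left_mult:
  "\<exists>w n. parse W w n \<and> foldr left_mult W ([], 0) = (w, int n)"
proof (induction W)
  case Nil
  then show ?case by (auto intro: exI[of _ 0] parse.Nil balanced.Nil)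
next
  case (Cons x W)
  then obtain w n where "parse W w n" "foldr left_mult W ([], 0) = (w, int n)" by blast
  then show ?case using parse_Cons[of W w n x] by simp
qed

lemma balanced_if_delta_power:
  assumes "bkl_word W = delta_power n"
  shows "balanced n W"
proof -
  have "foldr left_mult W ([], 0) = ([], int n)"
    using foldr_left_mult_eq[of W "delta_word n"] assms empty_normal_form
    by (simp add: foldr_left_mult_delta_word)
  then have "parse W [] n"
    using parse_foldr_left_mult[of W] by auto
  then show ?thesis
    by cases auto
qed

lemma bkl_word_balanced: "balanced n W \<Longrightarrow> bkl_word W = delta_power n"
proof (induction rule: balanced.induct)
  case (pair m U n V y x)
  have "bkl_word (x # U @ y # V) = bkl_braid x \<cdot> (delta_power m \<cdot> bkl_braid y) \<cdot> delta_power n"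
    using pair by (simp add: B3.m_assoc)
  also have "\<dots> = bkl_braid x \<cdot> bkl_braid (turn x) \<cdot> (delta_power m \<cdot> delta_power n)"
    using pair by (simp add: delta_power_bkl_braid B3.m_assoc)
  also have "\<dots> = delta_power (Suc (m + n))"
    using B3.nat_pow_mult[of bkl_delta 1 "m + n"]
    by (simp add: bkl_braid_turn B3.nat_pow_mult)
  finally show ?case .
qed simp

text \<open>
  The partner of \<open>r\<close> is the letter with which \<open>r\<close> forms a \<open>\<delta>\<close> after the power of \<open>\<delta>\<close> between
  them has moved away.
\<close>

lemma balanced_partner:
  assumes "balanced n (A @ r # C)"
  obtains (later) y U D m where "C = U @ y # D" "balanced m U" "(turn ^^ m) y = turn r"
  | (earlier) y U B m where "A = B @ y # U" "balanced m U" "(turn ^^ m) r = turn y"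
proof -
  have "(\<exists>y U D m. C = U @ y # D \<and> balanced m U \<and> (turn ^^ m) y = turn r) \<or>
    (\<exists>y U B m. A = B @ y # U \<and> balanced m U \<and> (turn ^^ m) r = turn y)"
    using assms
  proof (induction n "A @ r # C" arbitrary: A C rule: balanced.induct)
    case (pair m U n V y x)
    consider (1) "A = []" "r = x" "C = U @ y # V"
      | (2) A' D where "A = x # A'" "U = A' @ r # D" "C = D @ y # V"
      | (3) "A = x # U" "y = r" "V = C"
      | (4) B where "A = x # U @ y # B" "V = B @ r # C"
    proof (cases A)
      case Nil
      then show ?thesis using pair.hyps(6) 1 by simp
    next
      case (Cons z A')
      then have z: "A = x # A'" and "U @ (y # V) = A' @ (r # C)"
        using pair.hyps(6) by simp_all
      then obtain D where "U = A' @ D \<and> D @ (y # V) = r # C \<or> U @ D = A' \<and> y # V = D @ (r # C)"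
        by (auto simp: append_eq_append_conv2)
      then show ?thesis
        using 2[of A'] 3 4 z by (cases D) auto
    qed
    then show ?case
    proof cases
      case 1
      then show ?thesis using pair.hyps by blast
    next
      case 2
      from pair.hyps(2)[OF 2(2)] show ?thesis
      proof (elim disjE exE conjE)
        fix z T E k
        assume "D = T @ z # E" "balanced k T" "(turn ^^ k) z = turn r"
        then show ?thesis
          using 2 by (intro disjI1 exI[of _ z] exI[of _ T] exI[of _ "E @ y # V"] exI[of _ k]) simp
      next
        fix z T B k
        assume "A' = B @ z # T" "balanced k T" "(turn ^^ k) r = turn z"
        then show ?thesis
          using 2 by (intro disjI2 exI[of _ z] exI[of _ T] exI[of _ "x # B"] exI[of _ k]) simp
      qed
    next
      case 3
      then show ?thesis
        using pair.hyps(1,5) by (intro disjI2 exI[of _ x] exI[of _ U] exI[of _ "[]"] exI[of _ m]) simp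
    next
      case (4 F)
      from pair.hyps(4)[OF 4(2)] show ?thesis
      proof (elim disjE exE conjE)
        fix z T E k
        assume "C = T @ z # E" "balanced k T" "(turn ^^ k) z = turn r"
        then show ?thesis by blast
      next
        fix z T B k
        assume "F = B @ z # T" "balanced k T" "(turn ^^ k) r = turn z"
        then show ?thesis
          using 4 by (intro disjI2 exI[of _ z] exI[of _ T] exI[of _ "x # U @ y # B"] exI[of _ k]) simp
      qed
    qed
  qed simp
  then show ?thesis
    by (elim disjE exE conjE) (fact later, fact earlier)
qed

section \<open>Moving marks\<close>

definition marked_equiv :: "marked_word \<Rightarrow> marked_word \<Rightarrow> bool" where
  "marked_equiv m m' \<longleftrightarrow>
     hurwitz_equiv B3 (factors \<one>\<^bsub>B3\<^esub> m) (factors \<one>\<^bsub>B3\<^esub> m') \<and>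
     bkl_word (unmarked m) = bkl_word (unmarked m')"

lemma marked_equiv_refl [simp]: "marked_equiv m m"
  by (simp add: marked_equiv_def equivclp_def)

lemma marked_equiv_sym: "marked_equiv m m' \<Longrightarrow> marked_equiv m' m"
  by (auto simp: marked_equiv_def intro: equivclp_sym)

lemma marked_equiv_trans [trans]:
  "marked_equiv m m' \<Longrightarrow> marked_equiv m' m'' \<Longrightarrow> marked_equiv m m''"
  by (auto simp: marked_equiv_def intro: hurwitz_equiv_trans)

text \<open>
  A marked and an unmarked letter that become equal when they are moved together through the
  unmarked letters between them can exchange their marks: this moves the factor of the
  marked letter across the factors between both.
\<close>

lemma exchange_factors:
  assumes "bkl_braid y \<cdot> bkl_word (unmarked m2) = bkl_word (unmarked m2) \<cdot> bkl_braid t"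
  shows "\<exists>X\<in>carrier B3. \<exists>Y A B. set Y \<subseteq> carrier B3 \<and>
    factors \<one>\<^bsub>B3\<^esub> (m1 @ (y, True) # m2 @ (t, False) # m3) = A @ [X] @ Y @ B \<and>
    factors \<one>\<^bsub>B3\<^esub> (m1 @ (y, False) # m2 @ (t, True) # m3) = A @ map (conjugate B3 X) Y @ [X] @ B"
proof -
  define h R where "h = bkl_word (unmarked m1)" and "R = bkl_word (unmarked m2)"
  have c: "h \<in> carrier B3" "R \<in> carrier B3"
    by (simp_all add: h_def R_def)
  let ?y = "bkl_braid y" and ?t = "bkl_braid t"
  let ?X = "conjugate B3 h ?y"
  have yR: "?y \<cdot> R = R \<cdot> ?t" using assms by (simp add: R_def)
  have hy: "h \<cdot> ?y = ?X \<cdot> h"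
    using c by (simp add: B3.conjugate_mult_right)
  have X: "conjugate B3 (h \<cdot> ?y \<cdot> R) ?t = ?X"
  proof (rule B3.conjugate_eqI)
    have "h \<cdot> ?y \<cdot> R \<cdot> ?t = (h \<cdot> ?y) \<cdot> (?y \<cdot> R)"
      using c by (simp only: yR) (simp add: B3.m_assoc)
    also have "\<dots> = (?X \<cdot> h) \<cdot> (?y \<cdot> R)"
      by (simp only: hy)
    also have "\<dots> = ?X \<cdot> (h \<cdot> ?y \<cdot> R)"
      using c by (simp add: B3.m_assoc)
    finally show "h \<cdot> ?y \<cdot> R \<cdot> ?t = ?X \<cdot> (h \<cdot> ?y \<cdot> R)" .
  qed (use c in simp_all)
  have "h \<cdot> ?y \<cdot> R = h \<cdot> R \<cdot> ?t"
    using c by (simp add: yR B3.m_assoc)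
  moreover have "factors (h \<cdot> ?y) m2 = map (conjugate B3 ?X) (factors h m2)"
    unfolding hy using c by (intro factors_conjugate) simp_all
  ultimately show ?thesis
    using c X factors_closed[OF c(1), of m2]
    by (intro bexI[of _ ?X] exI[of _ "factors h m2"] exI[of _ "factors \<one>\<^bsub>B3\<^esub> m1"]
        exI[of _ "factors (h \<cdot> R \<cdot> ?t) m3"])
      (simp_all add: factors_append flip: h_def R_def)
qed

lemma exchange:
  assumes "bkl_braid y \<cdot> bkl_word (unmarked m2) = bkl_word (unmarked m2) \<cdot> bkl_braid t"
  shows "marked_equiv (m1 @ (y, True) # m2 @ (t, False) # m3) (m1 @ (y, False) # m2 @ (t, True) # m3)"
proof -
  have "hurwitz_equiv B3 (factors \<one>\<^bsub>B3\<^esub> (m1 @ (y, True) # m2 @ (t, False) # m3))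
      (factors \<one>\<^bsub>B3\<^esub> (m1 @ (y, False) # m2 @ (t, True) # m3))"
    using exchange_factors[OF assms, of m1 m3] hurwitz_equiv_slide by force
  moreover have "bkl_braid y \<cdot> (bkl_word (unmarked m2) \<cdot> z) = bkl_word (unmarked m2) \<cdot> (bkl_braid t \<cdot> z)"
    if "z \<in> carrier B3" for z
    using that assms by (simp flip: B3.m_assoc)
  ultimately show ?thesis
    by (simp add: marked_equiv_def)
qed

lemma unmarked_pair:
  "marked_equiv (u @ (x, False) # (turn x, False) # v) (u @ (y, False) # (turn y, False) # v)"
proof -
  have "bkl_braid x \<cdot> (bkl_braid (turn x) \<cdot> g) = bkl_braid y \<cdot> (bkl_braid (turn y) \<cdot> g)"
    if "g \<in> carrier B3" for g
    using that by (simp add: bkl_braid_turn flip: B3.m_assoc)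
  then show ?thesis
    by (simp add: marked_equiv_def factors_append bkl_braid_turn B3.m_assoc)
qed

text \<open>The three spellings of \<open>\<delta>\<close> are permuted cyclically by the Hurwitz move.\<close>

lemma marked_pair:
  "marked_equiv (u @ (x, True) # (turn x, True) # v) (u @ (y, True) # (turn y, True) # v)"
proof -
  have step: "marked_equiv (u @ (x, True) # (turn x, True) # v)
      (u @ (turn (turn x), True) # (x, True) # v)" for x
  proof -
    let ?g = "bkl_word (unmarked u)"
    have "bkl_braid x \<cdot> bkl_braid (turn x) = bkl_braid (turn (turn x)) \<cdot> bkl_braid x"
      using bkl_braid_turn[of x] bkl_braid_turn[of "turn (turn x)"] by simp
    then have "conjugate B3 (conjugate B3 ?g (bkl_braid x)) (conjugate B3 ?g (bkl_braid (turn x)))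
        = conjugate B3 ?g (bkl_braid (turn (turn x)))"
      by (intro B3.conjugate_eqI) (simp_all add: conjugate_def B3.m_assoc B3.inv_mult_cancel,
          simp flip: B3.m_assoc)
    then show ?thesis
      using hurwitz_equiv_move[of "conjugate B3 ?g (bkl_braid x)" B3
          "conjugate B3 ?g (bkl_braid (turn x))" "factors \<one>\<^bsub>B3\<^esub> u" "factors ?g v"]
      by (simp add: marked_equiv_def factors_append)
  qed
  consider "y = x" | "y = turn (turn x)" | "y = turn x"
    by (cases x; cases y) auto
  then show ?thesis
  proof cases
    case 2
    then show ?thesis using step[of x] by simp
  next
    case 3
    have "marked_equiv (u @ (turn (turn x), True) # (x, True) # v)
      (u @ (turn x, True) # (turn (turn x), True) # v)"
      using step[of "turn (turn x)"] by simp
    then show ?thesis using marked_equiv_trans[OF step] 3 by simp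
  qed simp
qed

lemma unmarked_eq_append:
  assumes "unmarked m = U @ y # V"
  obtains m1 m2 where "m = m1 @ (y, False) # m2" "unmarked m1 = U" "unmarked m2 = V"
proof -
  have "\<exists>m1 m2. m = m1 @ (y, False) # m2 \<and> unmarked m1 = U \<and> unmarked m2 = V"
    using assms
  proof (induction m arbitrary: U)
    case (Cons p m)
    obtain x b where p: "p = (x, b)" by (cases p)
    show ?case
    proof (cases b)
      case True
      then have "unmarked m = U @ y # V" using Cons.prems by (simp add: p)
      then obtain m1 m2 where "m = m1 @ (y, False) # m2" "unmarked m1 = U" "unmarked m2 = V"
        using Cons.IH by blast
      then show ?thesis
        using True by (intro exI[of _ "p # m1"] exI[of _ m2]) (simp add: p)
    next
      case False
      show ?thesis
      proof (cases U)
        case Nil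
        then show ?thesis
          using False Cons.prems by (intro exI[of _ "[]"] exI[of _ m]) (simp add: p)
      next
        case (Cons z U')
        then have "unmarked m = U' @ y # V" "z = x"
          using Cons.prems False by (simp_all add: p)
        then obtain m1 m2 where "m = m1 @ (y, False) # m2" "unmarked m1 = U'" "unmarked m2 = V"
          using Cons.IH by blast
        then show ?thesis
          using False Cons \<open>z = x\<close> by (intro exI[of _ "p # m1"] exI[of _ m2]) (simp add: p)
      qed
    qed
  qed simp
  then show ?thesis using that by blast
qed

text \<open>
  In a pair that forms \<open>\<delta>\<close>, let \<open>r\<close> be the only unmarked letter. The partner of \<open>r\<close> can
  take the mark of the other letter, because \<open>r\<close> forms a \<open>\<delta>\<close> with each of these two.
\<close>

lemma half_marked_pair:
  assumes m: "m = u @ (x, b) # (turn x, \<not> b) # v"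
    and delta: "bkl_word (unmarked m) = delta_power n"
  obtains u' v' where "map fst u' = map fst u" "map fst v' = map fst v"
    "marked_equiv m (u' @ (x, False) # (turn x, False) # v')"
proof -
  define r where "r = (if b then turn x else x)"
  have um: "unmarked m = unmarked u @ r # unmarked v"
    by (simp add: m r_def)
  then have "balanced n (unmarked u @ r # unmarked v)"
    using balanced_if_delta_power[OF delta] by simp
  then show ?thesis
  proof (cases rule: balanced_partner)
    case (later y U D k)
    then obtain v1 v2 where v: "v = v1 @ (y, False) # v2" "unmarked v1 = U"
      by (metis unmarked_eq_append)
    have U: "bkl_word U = delta_power k"
      using later by (simp add: bkl_word_balanced)
    \<comment> \<open>Both \<open>r \<delta>\<^sup>k y\<close> and the pair with \<open>\<delta>\<^sup>k\<close> are \<open>\<delta>\<^sup>k\<^sup>+\<^sup>1\<close>, so \<open>y\<close> is the other letter seen through \<open>\<delta>\<^sup>k\<close>.\<close>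
    have "delta_power k \<cdot> bkl_braid y = bkl_braid (turn r) \<cdot> delta_power k"
      using later by (simp add: delta_power_bkl_braid)
    then have "marked_equiv m (u @ (x, False) # (turn x, False) # v1 @ (y, True) # v2)"
      using exchange[of x "(turn x, False) # v1" y u v2] exchange[of "turn x" v1 y "u @ [(x, False)]" v2]
        bkl_braid_turn[of x] bkl_braid_turn[of "turn x"]
      by (cases b) (simp_all add: m v U r_def B3.m_assoc, simp_all flip: B3.m_assoc)
    then show ?thesis
      by (intro that[of u "v1 @ (y, True) # v2"]) (simp_all add: v)
  next
    case (earlier y U B k)
    then obtain u1 u2 where u: "u = u1 @ (y, False) # u2" "unmarked u2 = U"
      by (metis unmarked_eq_append)
    have U: "bkl_word U = delta_power k"
      using earlier by (simp add: bkl_word_balanced)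
    have y: "bkl_braid y \<cdot> delta_power k = delta_power k \<cdot> bkl_braid z" if "r = turn z" for z
      using earlier that by (simp add: delta_power_bkl_braid turn_pow_turn)
    have "marked_equiv m (u1 @ (y, True) # u2 @ (x, False) # (turn x, False) # v)"
    proof (cases b)
      case True
      then show ?thesis
        using exchange[of y u2 x u1 "(turn x, False) # v"] y[of x]
        by (simp add: m u U r_def marked_equiv_sym)
    next
      case False
      have "bkl_braid y \<cdot> (delta_power k \<cdot> bkl_braid x) = delta_power k \<cdot> (bkl_braid x \<cdot> bkl_braid (turn x))"
        using y[of "turn (turn x)"] False bkl_braid_turn[of x] bkl_braid_turn[of "turn (turn x)"]
        by (simp add: r_def flip: B3.m_assoc) (simp add: B3.m_assoc)
      then show ?thesis
        using exchange[of y "u2 @ [(x, False)]" "turn x" u1 v] False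
        by (simp add: m u U r_def marked_equiv_sym B3.m_assoc)
    qed
    then show ?thesis
      by (intro that[of "u1 @ (y, True) # u2" v]) (simp_all add: u)
  qed
qed

lemma marked_equiv_bkl_step:
  assumes "bkl_step (map fst m) W" "bkl_word (unmarked m) = delta_power n"
  obtains m' where "map fst m' = W" "marked_equiv m m'"
proof -
  obtain U x V y where UV: "map fst m = U @ [x, turn x] @ V" "W = U @ [y, turn y] @ V"
    using assms(1) by cases auto
  then obtain u b c v where m: "m = u @ (x, b) # (turn x, c) # v" "map fst u = U" "map fst v = V"
    by (auto simp: map_eq_append_conv map_eq_Cons_conv)
  consider "b" "c" | "\<not> b" "\<not> c" | "c = (\<not> b)" by blast
  then show ?thesis
  proof cases
    case 1
    show ?thesis
      by (rule that[of "u @ (y, True) # (turn y, True) # v"])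
        (use m UV 1 marked_pair in simp_all)
  next
    case 2
    show ?thesis
      by (rule that[of "u @ (y, False) # (turn y, False) # v"])
        (use m UV 2 unmarked_pair in simp_all)
  next
    case 3
    obtain u' v' where "map fst u' = map fst u" "map fst v' = map fst v"
      "marked_equiv m (u' @ (x, False) # (turn x, False) # v')"
      using half_marked_pair[of m u x b v n] m 3 assms(2) by blast
    then show ?thesis
      by (intro that[of "u' @ (y, False) # (turn y, False) # v'"])
        (use UV m in simp, rule marked_equiv_trans[OF _ unmarked_pair])
  qed
qed

lemma marked_equiv_bkl_steps:
  assumes "bkl_step\<^sup>*\<^sup>* (map fst m) W" "bkl_word (unmarked m) = delta_power n"
  shows "\<exists>m'. map fst m' = W \<and> marked_equiv m m'"
  using assms(1)
proof (induction rule: rtranclp_induct)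
  case base
  show ?case using marked_equiv_refl by blast
next
  case (step V W)
  then obtain m1 where m1: "map fst m1 = V" "marked_equiv m m1" by blast
  then obtain m2 where "map fst m2 = W" "marked_equiv m1 m2"
    using marked_equiv_bkl_step[of m1 W n] step.hyps(2) assms(2) by (auto simp: marked_equiv_def)
  then show ?case using m1 marked_equiv_trans by blast
qed

text \<open>
  A final pair with one mark is covered by \<open>half_marked_pair\<close>. If both of its letters are marked,
  it is first spelled such that it ends with the last unmarked letter \<open>z\<close> of the word. There is
  no other unmarked letter between the two occurrences of \<open>z\<close>, so these exchange their marks.
\<close>

lemma drop_final_delta:
  assumes W: "map fst m = W @ delta_word 1" and delta: "bkl_word (unmarked m) = delta_power (Suc n)"
  obtains m' where "map fst m' = W" "bkl_word (unmarked m') = delta_power n"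
    "hurwitz_equiv B3 (factors \<one>\<^bsub>B3\<^esub> m) (factors \<one>\<^bsub>B3\<^esub> m')"
proof -
  obtain u b c where m: "m = u @ [(S2, b), (turn S2, c)]" "map fst u = W"
    using W by (auto simp: map_eq_append_conv map_eq_Cons_conv)
  have half: "\<exists>u'. map fst u' = W \<and> marked_equiv m' (u' @ [(x, False), (turn x, False)])"
    if m': "m' = w @ [(x, d), (turn x, \<not> d)]" and w: "map fst w = W"
      and d: "bkl_word (unmarked m') = delta_power (Suc n)"
    for m' w x d
  proof -
    obtain u' v' where "map fst u' = map fst w" "map fst v' = map fst ([] :: marked_word)"
      "marked_equiv m' (u' @ (x, False) # (turn x, False) # v')"
      using half_marked_pair[OF m' d] .
    then show ?thesis using w by auto
  qed
  have "\<exists>u' x. map fst u' = W \<and> marked_equiv m (u' @ [(x, False), (turn x, False)])"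
  proof -
    consider (marked) "b" "c" | "\<not> b" "\<not> c" | "c = (\<not> b)" by blast
    then show ?thesis
    proof cases
      case marked
      have "unmarked m \<noteq> []"
      proof
        assume "unmarked m = []"
        then have "balanced (Suc n) []"
          using balanced_if_delta_power delta by metis
        then show False by cases
      qed
      then obtain V z where "unmarked m = V @ z # []"
        by (metis append_butlast_last_id)
      then have "unmarked u = V @ z # []"
        using marked by (simp add: m)
      then obtain u1 u2 where u: "u = u1 @ (z, False) # u2" "unmarked u2 = []"
        by (metis unmarked_eq_append)
      let ?y = "turn (turn z)"
      have "marked_equiv m (u1 @ (z, False) # (u2 @ [(?y, True)]) @ (z, True) # [])"
        using marked_pair[of u S2 "[]" ?y] marked by (simp add: m u)
      also have "marked_equiv \<dots> (u1 @ (z, True) # (u2 @ [(?y, True)]) @ (z, False) # [])"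
        by (intro marked_equiv_sym[OF exchange]) (simp add: u)
      finally have *: "marked_equiv m (u1 @ (z, True) # u2 @ [(?y, True), (turn ?y, False)])"
        by simp
      then obtain u' where "map fst u' = W"
        "marked_equiv (u1 @ (z, True) # u2 @ [(?y, True), (turn ?y, False)])
          (u' @ [(?y, False), (turn ?y, False)])"
        using half[of "u1 @ (z, True) # u2 @ [(?y, True), (turn ?y, False)]" "u1 @ (z, True) # u2" ?y True]
          m(2) delta by (auto simp: u marked_equiv_def)
      then show ?thesis using * marked_equiv_trans by blast
    next
      case 2
      then show ?thesis
        using m by (intro exI[of _ u] exI[of _ S2]) simp
    next
      case 3
      then show ?thesis using half[of m u S2 b] m delta by blast
    qed
  qed
  then obtain u' x where u': "map fst u' = W" "marked_equiv m (u' @ [(x, False), (turn x, False)])"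
    by blast
  have "bkl_word (unmarked u') \<cdot> bkl_delta = delta_power n \<cdot> bkl_delta"
    using u'(2) delta by (simp add: marked_equiv_def bkl_braid_turn)
  then have "bkl_word (unmarked u') = delta_power n"
    by simp
  then show ?thesis
    using that[of u'] u' by (simp add: marked_equiv_def factors_append)
qed

lemma drop_final_deltas:
  assumes "map fst m = W @ delta_word q" "bkl_word (unmarked m) = delta_power (n + q)"
  shows "\<exists>m'. map fst m' = W \<and> bkl_word (unmarked m') = delta_power n \<and>
    hurwitz_equiv B3 (factors \<one>\<^bsub>B3\<^esub> m) (factors \<one>\<^bsub>B3\<^esub> m')"
  using assms
proof (induction q arbitrary: m)
  case 0
  then show ?case by (auto simp: equivclp_def)
next
  case (Suc q)
  have "map fst m = (W @ delta_word q) @ delta_word 1"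
    using Suc.prems(1) delta_word_add[of q 1] by simp
  moreover have "bkl_word (unmarked m) = delta_power (Suc (n + q))"
    using Suc.prems(2) by simp
  ultimately obtain m1 where m1: "map fst m1 = W @ delta_word q"
    "bkl_word (unmarked m1) = delta_power (n + q)"
    "hurwitz_equiv B3 (factors \<one>\<^bsub>B3\<^esub> m) (factors \<one>\<^bsub>B3\<^esub> m1)"
    by (rule drop_final_delta)
  from Suc.IH[OF m1(1,2)] show ?case
    using hurwitz_equiv_trans[OF m1(3)] by blast
qed

section \<open>Marked words for quasipositive factorizations\<close>

text \<open>The rotation \<open>turn\<close> mixes the three letters, so the steps do not single out the two Artin generators.\<close>

lemma braid_induct [consumes 1, case_names one mult mult_inv]:
  assumes "g \<in> carrier B3"
    and one: "Q \<one>\<^bsub>B3\<^esub>"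
    and mult: "\<And>x g. g \<in> carrier B3 \<Longrightarrow> Q g \<Longrightarrow> Q (bkl_braid x \<cdot> g)"
    and mult_inv: "\<And>x g. g \<in> carrier B3 \<Longrightarrow> Q g \<Longrightarrow> Q (inv\<^bsub>B3\<^esub> bkl_braid x \<cdot> g)"
  shows "Q g"
proof -
  let ?S = "{1..<3::nat}" and ?R = "artin_relations 3"
  let ?cl = "\<lambda>w. pres_rel ?S ?R `` {w}"
  have cl: "?cl w \<in> carrier B3" if "w \<in> gwords ?S" for w
    using that by (auto simp: braid_group_def presented_group_def quotient_def)
  have mlt: "?cl u \<cdot> ?cl v = ?cl (u @ v)" if "u \<in> gwords ?S" "v \<in> gwords ?S" for u v
    using pres_mult[OF that] by (simp add: braid_group_def)
  have one_class: "\<one>\<^bsub>B3\<^esub> = ?cl []"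
    by (simp add: braid_group_def presented_group_def)
  have gen: "\<exists>x. ?cl [(i, True)] = bkl_braid x" if "i \<in> ?S" for i
  proof -
    have "?cl [(i, True)] = braid_gen 3 i"
      by (simp add: braid_gen_def pres_gen_def)
    moreover have "i = 1 \<or> i = 2" using that by auto
    ultimately show ?thesis
      using bkl_braid.simps(2,3) by metis
  qed
  have inv: "?cl [(i, False)] = inv\<^bsub>B3\<^esub> ?cl [(i, True)]" if "i \<in> ?S" for i
  proof (rule B3.inv_equality[symmetric])
    have "pres_eq ?S ?R ([] @ [(i, False), (i, \<not> False)] @ []) ([] @ [])"
      using that by (intro pres_eq.cancel) auto
    then have "?cl [(i, False), (i, True)] = ?cl []"
      by (intro equiv_class_eq[OF equiv_pres_rel]) (simp add: pres_rel_def)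
    moreover have "?cl [(i, False)] \<cdot> ?cl [(i, True)] = ?cl ([(i, False)] @ [(i, True)])"
      using that by (intro mlt) auto
    ultimately show "?cl [(i, False)] \<cdot> ?cl [(i, True)] = \<one>\<^bsub>B3\<^esub>"
      by (simp add: one_class)
  qed (use that cl in auto)
  obtain w where w: "w \<in> gwords ?S" "g = ?cl w"
    using assms(1) by (auto simp: braid_group_def presented_group_def quotient_def)
  from w(1) have "Q (?cl w)"
  proof (induction w)
    case Nil
    then show ?case using one by (simp add: one_class)
  next
    case (Cons p w)
    obtain i e where p: "p = (i, e)" by (cases p)
    then have i: "i \<in> ?S" using Cons.hyps by simp
    obtain x where x: "?cl [(i, True)] = bkl_braid x" using gen[OF i] by blast
    have "?cl (p # w) = ?cl [(i, e)] \<cdot> ?cl w"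
      using mlt[of "[(i, e)]" w] Cons.hyps p i by simp
    then show ?case
      using mult[OF cl Cons.IH, of x] mult_inv[OF cl Cons.IH, of x] Cons.hyps inv[OF i] x
      by (cases e) simp_all
  qed
  then show ?thesis using w by simp
qed

text \<open>
  An inverse letter in the conjugating braid becomes positive because
  \<open>x\<^sup>-\<^sup>1 = (turn x) \<delta>\<^sup>-\<^sup>1\<close> and conjugation by \<open>\<delta>\<close> only rotates the alphabet.
\<close>

lemma positive_conjugator:
  assumes "g \<in> carrier B3"
  shows "\<exists>P y. conjugate B3 g (bkl_braid x) = conjugate B3 (bkl_word P) (bkl_braid y)"
  using assms
proof (induction g rule: braid_induct)
  case one
  show ?case by (intro exI[of _ "[]"] exI[of _ x]) simp
next
  case (mult z g)
  then obtain P y where "conjugate B3 g (bkl_braid x) = conjugate B3 (bkl_word P) (bkl_braid y)"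
    by blast
  then show ?case
    using mult by (intro exI[of _ "z # P"] exI[of _ y]) (simp add: B3.conjugate_mult)
next
  case (mult_inv z g)
  then obtain P y where Py: "conjugate B3 g (bkl_braid x) = conjugate B3 (bkl_word P) (bkl_braid y)"
    by blast
  let ?P = "map (\<lambda>x. turn (turn x)) P" and ?y = "turn (turn y)"
  have "bkl_braid z \<cdot> (bkl_braid (turn z) \<cdot> bkl_word ?P) = delta_power 1 \<cdot> bkl_word ?P"
    by (simp add: bkl_braid_turn flip: B3.m_assoc)
  also have "\<dots> = bkl_word P \<cdot> bkl_delta"
    by (simp only: delta_power_bkl_word) (simp add: o_def)
  finally have "bkl_braid (turn z) \<cdot> bkl_word ?P = inv\<^bsub>B3\<^esub> bkl_braid z \<cdot> (bkl_word P \<cdot> bkl_delta)"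
    by (metis B3.inv_mult_cancel(1) B3.m_closed bkl_braid_closed bkl_word_closed)
  then have "conjugate B3 (bkl_word (turn z # ?P)) (bkl_braid ?y)
      = conjugate B3 (inv\<^bsub>B3\<^esub> bkl_braid z) (conjugate B3 (bkl_word P) (conjugate B3 bkl_delta (bkl_braid ?y)))"
    by (simp add: B3.conjugate_mult)
  also have "conjugate B3 bkl_delta (bkl_braid ?y) = bkl_braid y"
    by (rule B3.conjugate_eqI) (simp_all add: delta_bkl_braid)
  finally show ?case
    using mult_inv Py by (intro exI[of _ "turn z # ?P"] exI[of _ ?y]) (simp add: B3.conjugate_mult)
qed

lemma positive_complement: "\<exists>P'. bkl_word P \<cdot> bkl_word P' = delta_power (length P)"
proof (induction P)
  case Nil
  show ?case by (intro exI[of _ "[]"]) simp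
next
  case (Cons x P)
  then obtain P' where P': "bkl_word P \<cdot> bkl_word P' = delta_power (length P)" by blast
  obtain y where y: "(turn ^^ length P) y = turn x" using turn_pow_surj by blast
  have "bkl_word (x # P) \<cdot> bkl_word (P' @ [y])
      = bkl_braid x \<cdot> (bkl_word P \<cdot> bkl_word P') \<cdot> bkl_braid y"
    by (simp add: B3.m_assoc)
  also have "\<dots> = bkl_braid x \<cdot> (delta_power (length P) \<cdot> bkl_braid y)"
    by (simp add: P' B3.m_assoc)
  also have "\<dots> = bkl_delta \<cdot> delta_power (length P)"
    by (simp add: delta_power_bkl_braid y bkl_braid_turn flip: B3.m_assoc)
  also have "\<dots> = delta_power (length (x # P))"
    using B3.nat_pow_Suc2[of bkl_delta "length P"] by simp
  finally show ?case by blast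
qed

abbreviation turn_marked :: "nat \<Rightarrow> marked_word \<Rightarrow> marked_word" where
  "turn_marked n \<equiv> map (map_prod (turn ^^ n) id)"

lemma turn_marked_surj: "\<exists>m'. turn_marked n m' = m"
proof -
  have "(x, b) \<in> range (map_prod (turn ^^ n) id)" for x b
  proof -
    obtain y where "(turn ^^ n) y = x" using turn_pow_surj by blast
    then show ?thesis by (intro image_eqI[of _ _ "(y, b)"]) simp_all
  qed
  then have "surj (map_prod (turn ^^ n) (id :: bool \<Rightarrow> bool))" by auto
  then show ?thesis
    by (metis ex_map_conv surjD)
qed

lemma unmarked_turn_marked: "unmarked (turn_marked n m) = map (turn ^^ n) (unmarked m)"
  by (induction m) auto

lemma factors_turn_marked:
  "g \<in> carrier B3 \<Longrightarrow> factors (g \<cdot> delta_power n) m = factors g (turn_marked n m)"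
proof (induction m arbitrary: g)
  case (Cons p m)
  obtain x b where p: "p = (x, b)" by (cases p)
  have "conjugate B3 (delta_power n) (bkl_braid x) = bkl_braid ((turn ^^ n) x)"
    by (rule B3.conjugate_eqI) (simp_all add: delta_power_bkl_braid)
  moreover have "g \<cdot> delta_power n \<cdot> bkl_braid x = g \<cdot> bkl_braid ((turn ^^ n) x) \<cdot> delta_power n"
    using Cons.prems by (simp add: B3.m_assoc delta_power_bkl_braid)
  ultimately show ?case
    using Cons by (simp add: p B3.conjugate_mult)
qed simp

text \<open>
  A tuple \<open>(P y P\<^sup>-\<^sup>1, \<dots>)\<close> is realized by the words \<open>P y P' \<dots>\<close>, where \<open>P'\<close> completes \<open>P\<close> to a
  power of \<open>\<delta>\<close> and thus replaces \<open>P\<^sup>-\<^sup>1\<close> up to a rotation of everything that follows.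
\<close>

lemma factors_surj:
  assumes "\<forall>Y\<in>set xs. \<exists>g\<in>carrier B3. \<exists>x. Y = conjugate B3 g (bkl_braid x)"
  shows "\<exists>m q. bkl_word (unmarked m) = delta_power q \<and> factors \<one>\<^bsub>B3\<^esub> m = xs"
  using assms
proof (induction xs)
  case Nil
  show ?case by (intro exI[of _ "[]"] exI[of _ 0]) simp
next
  case (Cons Y xs)
  then obtain m q where m: "bkl_word (unmarked m) = delta_power q" "factors \<one>\<^bsub>B3\<^esub> m = xs"
    by auto
  obtain P y where Y: "Y = conjugate B3 (bkl_word P) (bkl_braid y)"
    using positive_conjugator Cons.prems by (metis list.set_intros(1))
  obtain P' where P': "bkl_word P \<cdot> bkl_word P' = delta_power (length P)"
    using positive_complement by blast
  obtain m' where m': "turn_marked (length P) m' = m"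
    using turn_marked_surj by blast
  let ?m = "map (\<lambda>x. (x, False)) P @ (y, True) # map (\<lambda>x. (x, False)) P' @ m'"
  have "factors (delta_power (length P)) m' = xs"
    using factors_turn_marked[of "\<one>\<^bsub>B3\<^esub>" "length P" m'] m m' by simp
  then have "factors \<one>\<^bsub>B3\<^esub> ?m = Y # xs"
    by (simp add: factors_append factors_unmarked unmarked_unmarked Y P')
  moreover have "bkl_word (unmarked ?m) = delta_power (q + length P)"
  proof -
    have "bkl_word (unmarked ?m) = bkl_word P \<cdot> bkl_word P' \<cdot> bkl_word (unmarked m')"
      by (simp add: unmarked_unmarked B3.m_assoc)
    also have "\<dots> = delta_power q \<cdot> delta_power (length P)"
      by (simp add: P' delta_power_bkl_word m(1) m' flip: unmarked_turn_marked)
    finally show ?thesis by (simp add: B3.nat_pow_mult)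
  qed
  ultimately show ?case by blast
qed

section \<open>Index sets and marks\<close>

definition mark :: "bkl_letter list \<Rightarrow> nat set \<Rightarrow> marked_word" where
  "mark W I = map (\<lambda>i. (W ! i, i \<in> I)) [0..<length W]"

lemma mark_snoc: "mark (W @ [x]) I = mark W I @ [(x, length W \<in> I)]"
  by (simp add: mark_def nth_append)

lemma mark_surj: "mark (map fst m) {i. i < length m \<and> snd (m ! i)} = m"
  by (rule nth_equalityI) (simp_all add: mark_def)

lemma unmarked_mark: "unmarked (mark W I) = nths W (- I)"
proof (induction W rule: rev_induct)
  case (snoc x W)
  then show ?case by (simp add: mark_snoc nths_append)
qed (simp add: mark_def)

lemma factors_mark:
  "factors \<one>\<^bsub>B3\<^esub> (mark W I) = map (\<lambda>i. conjugate B3 (bkl_word (index_prefix W I i)) (bkl_braid (W ! i)))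
    (filter (\<lambda>i. i \<in> I) [0..<length W])"
proof (induction W rule: rev_induct)
  case (snoc x W)
  have "index_prefix (W @ [x]) I i = index_prefix W I i" "(W @ [x]) ! i = W ! i"
    if "i \<in> set (filter (\<lambda>i. i \<in> I) [0..<length W])" for i
    using that by (simp_all add: index_prefix_def nth_append)
  moreover have "index_prefix (W @ [x]) I (length W) = unmarked (mark W I)"
    by (simp add: index_prefix_def unmarked_mark)
  ultimately show ?case
    using snoc by (simp add: mark_snoc factors_append cong: map_cong)
qed (simp add: mark_def)

lemma index_tuple_eq_factors:
  assumes "I \<subseteq> {..<length W}"
  shows "index_tuple W I = factors \<one>\<^bsub>B3\<^esub> (mark W I)"
proof -
  have "sorted_list_of_set I = filter (\<lambda>i. i \<in> I) [0..<length W]"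
  proof -
    have "set (filter (\<lambda>i. i \<in> I) [0..<length W]) = I" using assms by auto
    then show ?thesis
      by (metis distinct_filter distinct_upt sorted_list_of_set.idem_if_sorted_distinct
          sorted_upt sorted_wrt_filter)
  qed
  then show ?thesis
    by (simp add: index_tuple_def factors_mark conjugate_def)
qed

lemma marked_equiv_shift_mark:
  assumes "i \<notin> I" "Suc i \<in> I" "W ! i = W ! Suc i" "I \<subseteq> {..<length W}"
  shows "marked_equiv (mark W (insert i (I - {Suc i}))) (mark W I)"
proof -
  let ?f = "\<lambda>K j. (W ! j, j \<in> K)"
  define J where "J = insert i (I - {Suc i})"
  have JI: "j \<in> J \<longleftrightarrow> j \<in> I" if "j \<noteq> i" "j \<noteq> Suc i" for j
    using that by (auto simp: J_def)
  have upt: "[0..<length W] = [0..<i] @ i # Suc i # [Suc (Suc i)..<length W]"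
  proof -
    have "Suc i < length W" using assms by auto
    then show ?thesis
      using upt_add_eq_append[of 0 i "length W - i"] by (simp add: upt_conv_Cons)
  qed
  have mark: "mark W K = map (?f K) [0..<i] @ ?f K i # ?f K (Suc i) # map (?f K) [Suc (Suc i)..<length W]" for K
    unfolding mark_def upt by simp
  have "map (?f J) [0..<i] = map (?f I) [0..<i]"
    "map (?f J) [Suc (Suc i)..<length W] = map (?f I) [Suc (Suc i)..<length W]"
    using JI by auto
  then have "mark W J = map (?f I) [0..<i] @ (W ! i, True) # [] @ (W ! i, False) # map (?f I) [Suc (Suc i)..<length W]"
    using mark[of J] assms(3) by (simp add: J_def)
  moreover have "mark W I = map (?f I) [0..<i] @ (W ! i, False) # [] @ (W ! i, True) # map (?f I) [Suc (Suc i)..<length W]"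
    using mark[of I] assms by simp
  ultimately show ?thesis
    unfolding J_def[symmetric] by (simp only: exchange unmarked_simps bkl_word_Nil B3.l_one B3.r_one bkl_braid_closed)
qed

text \<open>Shifting a mark to an equal left neighbour lowers the sum of the positions, so a choice with least sum is minimal.\<close>

lemma exists_minimal_mark:
  assumes "I0 \<subseteq> {..<length W}"
  shows "\<exists>I\<subseteq>{..<length W}. word_minimal W I \<and> marked_equiv (mark W I0) (mark W I)"
proof -
  let ?Q = "\<lambda>I. I \<subseteq> {..<length W} \<and> marked_equiv (mark W I0) (mark W I)"
  obtain I where I: "?Q I" and least: "\<And>J. ?Q J \<Longrightarrow> \<Sum>I \<le> \<Sum>J"
    using ex_has_least_nat[of ?Q I0 "\<lambda>I. \<Sum>I"] assms by auto
  have "word_minimal W I"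
    unfolding word_minimal_def
  proof
    assume "\<exists>i. i \<notin> I \<and> Suc i \<in> I \<and> W ! i = W ! Suc i"
    then obtain i where i: "i \<notin> I" "Suc i \<in> I" "W ! i = W ! Suc i" by blast
    let ?J = "insert i (I - {Suc i})"
    have fin: "finite I" using I finite_subset by blast
    have "?J \<subseteq> {..<length W}" using I i by auto
    then have "?Q ?J"
      using marked_equiv_trans[OF _ marked_equiv_sym[OF marked_equiv_shift_mark]] I i by blast
    then have "\<Sum>I \<le> \<Sum>?J" by (rule least)
    moreover have "\<Sum>?J = i + \<Sum>(I - {Suc i})"
      using fin i by (subst sum.insert) auto
    moreover have "\<Sum>I = Suc i + \<Sum>(I - {Suc i})"
      using fin i by (simp add: sum.remove[of I "Suc i"])
    ultimately show False by simp
  qed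
  then show ?thesis using I by blast
qed

theorem theorem2:
  fixes W :: "bkl_letter list" and p :: nat and X :: braid
  assumes "X = bkl_word W \<otimes>\<^bsub>B3\<^esub> bkl_delta [^]\<^bsub>B3\<^esub> (- int p)"
    and "quasipositive X"
  shows "\<forall>k. \<forall>\<Omega>\<in>orbits (braid_group k) (qp_factorizations k X) (hurwitz_action B3 k).
           \<exists>I\<subseteq>{..<length W}. word_minimal W I \<and> index_tuple W I \<in> \<Omega>"
proof (intro allI ballI)
  fix k \<Omega>
  assume "\<Omega> \<in> orbits (braid_group k) (qp_factorizations k X) (hurwitz_action B3 k)"
  then obtain xs where \<Omega>: "\<Omega> = orbit (braid_group k) (hurwitz_action B3 k) xs"
    and xs: "length xs = k" "qp_factorization X xs"
    by (auto simp: orbits_def qp_factorizations_def)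
  have prod: "foldr (\<otimes>\<^bsub>B3\<^esub>) xs \<one>\<^bsub>B3\<^esub> = X"
    using xs by (simp add: qp_factorization_def)
  have "\<forall>Y\<in>set xs. \<exists>g\<in>carrier B3. \<exists>x. Y = conjugate B3 g (bkl_braid x)"
    using xs(2) unfolding qp_factorization_def conjugate_def by (metis bkl_braid.simps(2))
  then obtain m q where m: "bkl_word (unmarked m) = delta_power q" "factors \<one>\<^bsub>B3\<^esub> m = xs"
    using factors_surj by blast
  have tup: "xs \<in> tuples B3 k"
    using xs(1) factors_closed[of "\<one>\<^bsub>B3\<^esub>" m] m(2) by (simp add: tuples_def)
  let ?m = "m @ map (\<lambda>x. (x, False)) (delta_word p)"
  have m': "bkl_word (unmarked ?m) = delta_power (p + q)" "factors \<one>\<^bsub>B3\<^esub> ?m = xs"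
    using m by (simp_all add: unmarked_unmarked factors_append factors_unmarked B3.nat_pow_mult add.commute)
  have "bkl_word (map fst ?m) = X \<cdot> delta_power (p + q)"
    using prod_factors[of "\<one>\<^bsub>B3\<^esub>" ?m] m' prod by simp
  also have "\<dots> = bkl_word W \<cdot> (bkl_delta [^]\<^bsub>B3\<^esub> (- int p) \<cdot> delta_power (p + q))"
    using assms(1) by (simp add: B3.m_assoc)
  also have "bkl_delta [^]\<^bsub>B3\<^esub> (- int p) \<cdot> delta_power (p + q) = delta_power q"
    using B3.int_pow_mult[of bkl_delta "- int p" "int (p + q)"] by (simp only: int_pow_int) (simp flip: int_pow_int)
  also have "bkl_word W \<cdot> delta_power q = bkl_word (W @ delta_word q)"
    by simp
  finally have "bkl_step\<^sup>*\<^sup>* (map fst ?m) (W @ delta_word q)"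
    by (rule bkl_steps_if_bkl_word_eq)
  then obtain m2 where m2: "map fst m2 = W @ delta_word q" "marked_equiv ?m m2"
    using marked_equiv_bkl_steps m'(1) by blast
  then obtain m3 where m3: "map fst m3 = W"
    "hurwitz_equiv B3 (factors \<one>\<^bsub>B3\<^esub> m2) (factors \<one>\<^bsub>B3\<^esub> m3)"
    using drop_final_deltas[of m2 W q p] m'(1) unfolding marked_equiv_def by metis
  define J where "J = {i. i < length m3 \<and> snd (m3 ! i)}"
  have J: "J \<subseteq> {..<length W}" "mark W J = m3"
    using m3(1) mark_surj[of m3] by (auto simp: J_def)
  obtain I where I: "I \<subseteq> {..<length W}" "word_minimal W I" "marked_equiv m3 (mark W I)"
    using exists_minimal_mark[OF J(1)] J(2) by auto
  have "hurwitz_equiv B3 xs (index_tuple W I)"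
    using m2(2) m3(2) I hurwitz_equiv_trans unfolding marked_equiv_def m'(2) index_tuple_eq_factors[OF I(1)]
    by metis
  then have "index_tuple W I \<in> \<Omega>"
    unfolding \<Omega> using hurwitz_equiv_orbit[OF group_braid_group] tup by blast
  then show "\<exists>I\<subseteq>{..<length W}. word_minimal W I \<and> index_tuple W I \<in> \<Omega>"
    using I by blast
qed

end
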